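(* The set of finite TRSs $R$ that are strongly normalizing (i.e. strongly normalizing on every term) is $\Pi^0_2$-complete. Likewise, the set of finite TRSs that are weakly normalizing (on every term) is $\Pi^0_2$-complete.
   Context: All TRSs are finite sets of rules over a finite signature; terms may contain variables. A TRS $R$ is strongly normalizing on a term $t$ if every $\to_R$-rewrite sequence starting from $t$ is finite, and weakly normalizing on $t$ if $t\to_R^* s$ for some $\to_R$-normal form $s$. TRSs and terms are encoded as natural numbers by a standard effective Gödel numbering, and properties are identified with the corresponding sets of codes. $\Sigma^0_n,\Pi^0_n$ are the classes of the arithmetical hierarchy; a set $B$ is $\mathcal P$-complete if $B\in\mathcal P$ and every $A\in\mathcal P$ is many-one reducible to $B$ via a total computable function. *)

theory Defs
  imports Main "HOL-Library.Nat_Bijection"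
begin

text \<open>First-order terms: function symbols and variables are natural numbers;
  the arity of an occurrence Fun f ts is length ts.\<close>
datatype trm = Var nat | Fun nat "trm list"

fun vars :: "trm \<Rightarrow> nat set" where
  "vars (Var x) = {x}"
| "vars (Fun f ts) = (\<Union>t\<in>set ts. vars t)"

fun subst :: "(nat \<Rightarrow> trm) \<Rightarrow> trm \<Rightarrow> trm" where
  "subst \<sigma> (Var x) = \<sigma> x"
| "subst \<sigma> (Fun f ts) = Fun f (map (subst \<sigma>) ts)"

text \<open>A signature is a finite list of (symbol, arity) pairs.\<close>
type_synonym signature = "(nat \<times> nat) list"
type_synonym rule = "trm \<times> trm"

fun wf_term :: "signature \<Rightarrow> trm \<Rightarrow> bool" where
  "wf_term F (Var x) = True"
| "wf_term F (Fun f ts) = ((f, length ts) \<in> set F \<and> (\<forall>t\<in>set ts. wf_term F t))"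

type_synonym trs = "signature \<times> rule list"

definition wf_trs :: "trs \<Rightarrow> bool" where
  "wf_trs R \<longleftrightarrow> distinct (map fst (fst R)) \<and>
     (\<forall>(l, r) \<in> set (snd R). (\<exists>f ts. l = Fun f ts) \<and> vars r \<subseteq> vars l \<and>
        wf_term (fst R) l \<and> wf_term (fst R) r)"

inductive_set rstep :: "rule list \<Rightarrow> (trm \<times> trm) set" for Rs where
  root: "(l, r) \<in> set Rs \<Longrightarrow> (subst \<sigma> l, subst \<sigma> r) \<in> rstep Rs"
| ctxt: "(s, t) \<in> rstep Rs \<Longrightarrow> (Fun f (ss @ s # us), Fun f (ss @ t # us)) \<in> rstep Rs"

definition SN_on :: "trs \<Rightarrow> trm \<Rightarrow> bool" where
  "SN_on R t \<longleftrightarrow> \<not> (\<exists>g. g 0 = t \<and> (\<forall>i. (g i, g (Suc i)) \<in> rstep (snd R)))"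

definition NF :: "trs \<Rightarrow> trm \<Rightarrow> bool" where
  "NF R s \<longleftrightarrow> \<not> (\<exists>u. (s, u) \<in> rstep (snd R))"

definition WN_on :: "trs \<Rightarrow> trm \<Rightarrow> bool" where
  "WN_on R t \<longleftrightarrow> (\<exists>s. (t, s) \<in> (rstep (snd R))\<^sup>* \<and> NF R s)"

definition SN_trs :: "trs \<Rightarrow> bool" where
  "SN_trs R \<longleftrightarrow> (\<forall>t. wf_term (fst R) t \<longrightarrow> SN_on R t)"

definition WN_trs :: "trs \<Rightarrow> bool" where
  "WN_trs R \<longleftrightarrow> (\<forall>t. wf_term (fst R) t \<longrightarrow> WN_on R t)"

fun enc_term :: "trm \<Rightarrow> nat" where
  "enc_term (Var x) = prod_encode (0, x)"
| "enc_term (Fun f ts) = prod_encode (1, prod_encode (f, list_encode (map enc_term ts)))"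

definition enc_trs :: "trs \<Rightarrow> nat" where
  "enc_trs R = prod_encode (list_encode (map prod_encode (fst R)),
       list_encode (map (\<lambda>(l, r). prod_encode (enc_term l, enc_term r)) (snd R)))"

definition SN_codes :: "nat set" where
  "SN_codes = {enc_trs R | R. wf_trs R \<and> SN_trs R}"

definition WN_codes :: "nat set" where
  "WN_codes = {enc_trs R | R. wf_trs R \<and> WN_trs R}"

datatype recf = Z | Suc_f | Proj nat | Comp recf "recf list" | Prec recf recf | Mn recf

inductive eval :: "recf \<Rightarrow> nat list \<Rightarrow> nat \<Rightarrow> bool" where
  eval_Z: "eval Z xs 0"
| eval_Suc: "eval Suc_f (x # xs) (Suc x)"
| eval_Proj: "i < length xs \<Longrightarrow> eval (Proj i) xs (xs ! i)"
| eval_Comp: "list_all2 (\<lambda>g y. eval g xs y) gs ys \<Longrightarrow> eval f ys y \<Longrightarrow> eval (Comp f gs) xs y"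
| eval_Prec0: "eval g xs y \<Longrightarrow> eval (Prec g h) (0 # xs) y"
| eval_PrecS: "eval (Prec g h) (n # xs) r \<Longrightarrow> eval h (n # r # xs) y \<Longrightarrow>
     eval (Prec g h) (Suc n # xs) y"
| eval_Mn: "eval f (y # xs) 0 \<Longrightarrow> (\<forall>z<y. \<exists>v. v > 0 \<and> eval f (z # xs) v) \<Longrightarrow>
     eval (Mn f) xs y"

definition total_computable :: "(nat \<Rightarrow> nat) \<Rightarrow> bool" where
  "total_computable h \<longleftrightarrow> (\<exists>c. \<forall>x. eval c [x] (h x))"

definition decidable3 :: "(nat \<Rightarrow> nat \<Rightarrow> nat \<Rightarrow> bool) \<Rightarrow> bool" where
  "decidable3 P \<longleftrightarrow> (\<exists>c. \<forall>x y z. eval c [x, y, z] (if P x y z then 1 else 0))"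

definition Pi02 :: "nat set \<Rightarrow> bool" where
  "Pi02 A \<longleftrightarrow> (\<exists>P. decidable3 P \<and> (\<forall>x. x \<in> A \<longleftrightarrow> (\<forall>y. \<exists>z. P x y z)))"

definition many_one_reducible :: "nat set \<Rightarrow> nat set \<Rightarrow> bool" where
  "many_one_reducible A B \<longleftrightarrow> (\<exists>h. total_computable h \<and> (\<forall>x. x \<in> A \<longleftrightarrow> h x \<in> B))"

definition Pi02_complete :: "nat set \<Rightarrow> bool" where
  "Pi02_complete B \<longleftrightarrow> Pi02 B \<and> (\<forall>A. Pi02 A \<longrightarrow> many_one_reducible A B)"

end

theory Submission
  imports Defs
begin

text \<open>
  Membership: the finitely many one-step reducts of a term can be computed, so by Koenig's lemma
  \<open>t\<close> is strongly normalizing iff for some \<open>n\<close> it has no reduct after exactly \<open>n\<close> steps, and it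
  is weakly normalizing iff for some \<open>n\<close> one of its reducts after \<open>n\<close> steps is normal.

  Hardness: for decidable \<open>P\<close> one TRS serves both properties.  It interprets, as a deterministic
  abstract machine, the program that searches for \<open>z\<close> with \<open>P x y z\<close>.  Machine states unreachable from
  the initial one could run forever, so the machine only runs on a finite grant of steps; when the
  grant is exhausted, the computation restarts from its initial state with a larger grant.  Thus an
  infinite reduction has to restart infinitely often, and after two restarts it is an honest search
  on a numeral \<open>y\<close>, which halts within some grant if a witness exists.  Conversely, the search
  on an input \<open>y\<close> without witness is deterministic and never reaches a normal form.
\<close>

section \<open>Recursive functions on lists of arguments\<close>

text \<open>Uniform normalization quantifies over all terms, hence also over configurations that no
  computation produces: forged stacks, variables in place of inputs, redexes nested in arguments. A
  plain interpreter fails here, since an arbitrary state may contain a different, diverging program.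
  So nothing in the current state is trusted for long: at a restart the program comes from the rule
  itself, and the input only gets through if it survives being copied. Two restarts are needed
  because the two data are cleaned at different moments. Copying into \<open>zr\<close> turns the
  input into a numeral, while the grant of the run that follows still stems from an unknown old
  count. That run, however, counts from \<open>zr\<close>, so the grant after it is a numeral too. A
  halted machine with some grant left is a normal form; this is how a successful search ends a
  reduction. A failing search yields a term without any normal form, which refutes weak and strong
  normalization alike. Computability is proved by closure rules, collected in
  \<open>recursive_intros\<close> and \<open>computable_intros\<close>, that follow the shape of a
  definition.\<close>

definition recursive :: "nat \<Rightarrow> (nat list \<Rightarrow> nat) \<Rightarrow> bool" where
  "recursive k f \<longleftrightarrow> (\<exists>c. \<forall>xs. length xs = k \<longrightarrow> eval c xs (f xs))"

lemma recursiveI: "(\<And>xs. length xs = k \<Longrightarrow> eval c xs (f xs)) \<Longrightarrow> recursive k f"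
  unfolding recursive_def by blast

named_theorems recursive_intros

lemma total_computable_iff_recursive: "total_computable h \<longleftrightarrow> recursive 1 (\<lambda>xs. h (xs ! 0))"
proof -
  have "(\<forall>x. eval c [x] (h x)) \<longleftrightarrow> (\<forall>xs. length xs = 1 \<longrightarrow> eval c xs (h (xs ! 0)))" for c
    by (auto simp: length_Suc_conv)
  then show ?thesis
    unfolding total_computable_def recursive_def by simp
qed

lemma recursive_compose:
  assumes "recursive n g" "list_all (recursive k) fs" "length fs = n"
  shows "recursive k (\<lambda>xs. g (map (\<lambda>f. f xs) fs))"
proof -
  obtain cg where cg: "\<And>ys. length ys = n \<Longrightarrow> eval cg ys (g ys)"
    using assms(1) unfolding recursive_def by blast
  have "\<exists>cs. \<forall>xs. length xs = k \<longrightarrow> list_all2 (\<lambda>c y. eval c xs y) cs (map (\<lambda>f. f xs) fs)"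
    using assms(2)
  proof (induction fs)
    case Nil
    then show ?case by (intro exI[of _ "[]"]) simp
  next
    case (Cons f fs)
    then obtain cs where "\<forall>xs. length xs = k \<longrightarrow> list_all2 (\<lambda>c y. eval c xs y) cs (map (\<lambda>f. f xs) fs)"
      by auto
    moreover obtain c where "\<forall>xs. length xs = k \<longrightarrow> eval c xs (f xs)"
      using Cons.prems unfolding recursive_def by auto
    ultimately show ?case by (intro exI[of _ "c # cs"]) simp
  qed
  then obtain cs where
    "\<And>xs. length xs = k \<Longrightarrow> list_all2 (\<lambda>c y. eval c xs y) cs (map (\<lambda>f. f xs) fs)"
    by blast
  then show ?thesis
    by (intro recursiveI[of _ "Comp cg cs"] eval_Comp) (auto simp: cg assms(3))
qed

lemma recursive_compose1:
  assumes "recursive 1 (\<lambda>xs. g (xs ! 0))" "recursive k a"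
  shows "recursive k (\<lambda>xs. g (a xs))"
  using recursive_compose[OF assms(1), of k "[a]"] assms(2) by simp

lemma recursive_compose2:
  assumes "recursive 2 (\<lambda>xs. g (xs ! 0) (xs ! 1))" "recursive k a" "recursive k b"
  shows "recursive k (\<lambda>xs. g (a xs) (b xs))"
  using recursive_compose[OF assms(1), of k "[a, b]"] assms(2,3) by simp

lemma recursive_compose3:
  assumes "recursive 3 (\<lambda>xs. g (xs ! 0) (xs ! 1) (xs ! 2))"
    "recursive k a" "recursive k b" "recursive k c"
  shows "recursive k (\<lambda>xs. g (a xs) (b xs) (c xs))"
  using recursive_compose[OF assms(1), of k "[a, b, c]"] assms(2-) by (simp add: numeral_2_eq_2)

lemma recursive_nth [recursive_intros]: "i < k \<Longrightarrow> recursive k (\<lambda>xs. xs ! i)"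
  by (intro recursiveI[of _ "Proj i"] eval_Proj) simp

lemma recursive_Suc [recursive_intros]:
  assumes "recursive k f"
  shows "recursive k (\<lambda>xs. Suc (f xs))"
proof -
  have "recursive 1 (\<lambda>xs. Suc (xs ! 0))"
    by (intro recursiveI[of _ Suc_f]) (auto simp: length_Suc_conv intro: eval_Suc)
  then show ?thesis using assms by (rule recursive_compose1)
qed

lemma recursive_const [recursive_intros]: "recursive k (\<lambda>_. n)"
proof (induction n)
  case 0
  show ?case by (rule recursiveI[of _ Z]) (rule eval_Z)
next
  case (Suc n)
  then show ?case by (rule recursive_Suc)
qed

lemma recursive_rec_nat_tl:
  assumes g: "recursive k g" and h: "recursive (Suc (Suc k)) h"
  shows "recursive (Suc k) (\<lambda>xs. rec_nat (g (tl xs)) (\<lambda>m r. h (m # r # tl xs)) (hd xs))"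
proof -
  obtain cg ch where c: "\<And>xs. length xs = k \<Longrightarrow> eval cg xs (g xs)"
    "\<And>xs. length xs = Suc (Suc k) \<Longrightarrow> eval ch xs (h xs)"
    using g h unfolding recursive_def by blast
  have "eval (Prec cg ch) (n # xs) (rec_nat (g xs) (\<lambda>m r. h (m # r # xs)) n)"
    if "length xs = k" for n xs
    by (induction n) (auto intro!: eval_Prec0 eval_PrecS c simp: that)
  then show ?thesis
    by (intro recursiveI[of _ "Prec cg ch"]) (auto simp: length_Suc_conv)
qed

text \<open>Primitive recursion puts the counter and the previous result in front of the parameters,
  so inside the step function the old arguments are \<open>tl (tl xs)\<close>. In this form the rule
  applies to any \<open>rec_nat\<close> whose step mentions \<open>xs\<close>.\<close>

lemma recursive_rec_nat [recursive_intros]: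
  assumes n: "recursive k n" and g: "recursive k g"
    and h: "recursive (Suc (Suc k)) (\<lambda>xs. h (xs ! 0) (xs ! 1) (tl (tl xs)))"
  shows "recursive k (\<lambda>xs. rec_nat (g xs) (\<lambda>m r. h m r xs) (n xs))"
proof -
  let ?F = "\<lambda>xs. rec_nat (g (tl xs)) (\<lambda>m r. h m r (tl xs)) (hd xs)"
  obtain c cn where c: "\<And>xs. length xs = Suc k \<Longrightarrow> eval c xs (?F xs)"
    and cn: "\<And>xs. length xs = k \<Longrightarrow> eval cn xs (n xs)"
    using recursive_rec_nat_tl[OF g h] n unfolding recursive_def by auto
  let ?cs = "cn # map Proj [0..<k]"
  have "eval (Comp c ?cs) xs (?F (n xs # xs))" if "length xs = k" for xs
  proof (rule eval_Comp)
    have "list_all2 (\<lambda>g y. eval g xs y) (map Proj [0..<k]) xs"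
      using that by (auto simp: list_all2_conv_all_nth intro: eval_Proj)
    then show "list_all2 (\<lambda>g y. eval g xs y) ?cs (n xs # xs)"
      using cn that by simp
  qed (use c[of "n xs # xs"] that in simp)
  then show ?thesis by (intro recursiveI[of _ "Comp c ?cs"]) simp
qed

lemma recursive_cong:
  assumes "\<And>xs. length xs = k \<Longrightarrow> f xs = g xs" "recursive k g"
  shows "recursive k f"
  using assms unfolding recursive_def by metis

lemma recursive_nth_tl_tl [recursive_intros]:
  assumes "Suc (Suc i) < k"
  shows "recursive k (\<lambda>xs. tl (tl xs) ! i)"
proof (rule recursive_cong)
  show "recursive k (\<lambda>xs. xs ! Suc (Suc i))" using assms by (rule recursive_nth)
  show "tl (tl xs) ! i = xs ! Suc (Suc i)" if "length xs = k" for xs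
    using that assms by (simp add: nth_tl)
qed

lemma recursive_add [recursive_intros]:
  assumes "recursive k a" "recursive k b"
  shows "recursive k (\<lambda>xs. a xs + b xs)"
proof (rule recursive_compose2[OF _ assms], rule recursive_cong)
  show "recursive 2 (\<lambda>xs. rec_nat (xs ! 1) (\<lambda>m r. Suc r) (xs ! 0))"
    by (intro recursive_intros) simp_all
  have "rec_nat m (\<lambda>m r. Suc r) n = n + m" for n m :: nat by (induction n) auto
  then show "xs ! 0 + xs ! 1 = rec_nat (xs ! 1) (\<lambda>m r. Suc r) (xs ! 0)" for xs by simp
qed

lemma recursive_pred [recursive_intros]:
  assumes "recursive k a"
  shows "recursive k (\<lambda>xs. a xs - 1)"
proof (rule recursive_compose1[OF _ assms], rule recursive_cong)
  show "recursive 1 (\<lambda>xs. rec_nat 0 (\<lambda>m r. m) (xs ! 0))"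
    by (intro recursive_intros) simp_all
  have "rec_nat 0 (\<lambda>m r. m) n = n - 1" for n :: nat by (cases n) auto
  then show "xs ! 0 - 1 = rec_nat 0 (\<lambda>m r. m) (xs ! 0)" for xs by simp
qed

lemma recursive_diff [recursive_intros]:
  assumes "recursive k a" "recursive k b"
  shows "recursive k (\<lambda>xs. a xs - b xs)"
proof (rule recursive_compose2[OF _ assms], rule recursive_cong)
  show "recursive 2 (\<lambda>xs. rec_nat (xs ! 0) (\<lambda>m r. r - 1) (xs ! 1))"
    by (intro recursive_intros) simp_all
  have "rec_nat m (\<lambda>m r. r - 1) n = m - n" for n m :: nat by (induction n) auto
  then show "xs ! 0 - xs ! 1 = rec_nat (xs ! 0) (\<lambda>m r. r - 1) (xs ! 1)" for xs by simp
qed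

lemma recursive_if_pos [recursive_intros]:
  assumes "recursive k a" "recursive k b" "recursive k c"
  shows "recursive k (\<lambda>xs. if 0 < a xs then b xs else c xs)"
proof (rule recursive_compose3[OF _ assms], rule recursive_cong)
  show "recursive 3 (\<lambda>xs. rec_nat (xs ! 2) (\<lambda>m r. xs ! 1) (xs ! 0))"
    by (intro recursive_intros) simp_all
  have "rec_nat m (\<lambda>m r. p) n = (if 0 < n then p else m)" for n m p :: nat by (cases n) auto
  then show "(if 0 < xs ! 0 then xs ! 1 else xs ! 2) =
      rec_nat (xs ! 2) (\<lambda>m r. xs ! 1) (xs ! 0)" for xs by simp
qed

lemma recursive_triangle [recursive_intros]:
  assumes "recursive k a"
  shows "recursive k (\<lambda>xs. triangle (a xs))"
proof (rule recursive_compose1[OF _ assms], rule recursive_cong)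
  show "recursive 1 (\<lambda>xs. rec_nat 0 (\<lambda>m r. r + Suc m) (xs ! 0))"
    by (intro recursive_intros) simp_all
  have "rec_nat 0 (\<lambda>m r. r + Suc m) n = triangle n" for n :: nat by (induction n) auto
  then show "triangle (xs ! 0) = rec_nat 0 (\<lambda>m r. r + Suc m) (xs ! 0)" for xs by simp
qed

lemma recursive_prod_encode [recursive_intros]:
  assumes "recursive k a" "recursive k b"
  shows "recursive k (\<lambda>xs. prod_encode (a xs, b xs))"
  unfolding prod_encode_def split_conv by (intro recursive_intros assms)

section \<open>Inverting the Cantor pairing function\<close>

definition diagonal :: "nat \<Rightarrow> nat" where
  "diagonal n = fst (prod_decode n) + snd (prod_decode n)"

lemma prod_decode_Suc:
  "prod_decode (Suc n) = (case prod_decode n of (a, b) \<Rightarrow> if b = 0 then (0, Suc a) else (Suc a, b - 1))"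
proof -
  obtain a b where ab: "prod_decode n = (a, b)" by fastforce
  then have n: "n = prod_encode (a, b)" by (metis prod_decode_inverse)
  let ?p = "if b = 0 then (0, Suc a) else (Suc a, b - 1)"
  have "prod_encode ?p = Suc n"
    by (cases b) (auto simp: n prod_encode_def)
  then show ?thesis by (metis ab prod_encode_inverse split_conv)
qed

lemma prod_decode_0: "prod_decode 0 = (0, 0)"
  using prod_encode_inverse[of "(0, 0)"] by (simp add: prod_encode_def)

lemma triangle_diagonal: "n = triangle (diagonal n) + fst (prod_decode n)"
  using prod_decode_inverse[of n] by (simp add: prod_encode_def diagonal_def split_beta)

text \<open>Antidiagonal \<open>d\<close> holds the codes from \<open>triangle d\<close> up to but
  excluding \<open>triangle (Suc d)\<close>, so the index moves on exactly when \<open>Suc n\<close>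
  reaches that bound. The comparison is a truncated difference because
  \<open>recursive_if_pos\<close> tests for positivity.\<close>

lemma diagonal_Suc:
  "diagonal (Suc n) = (if 0 < triangle (Suc (diagonal n)) - Suc n then diagonal n else Suc (diagonal n))"
proof -
  obtain a b where ab: "prod_decode n = (a, b)" by fastforce
  then have d: "diagonal n = a + b" by (simp add: diagonal_def)
  have "diagonal (Suc n) = (if b = 0 then Suc a else a + b)"
    by (auto simp: diagonal_def prod_decode_Suc ab)
  moreover have "n = triangle (a + b) + a" using triangle_diagonal[of n] d ab by simp
  ultimately show ?thesis unfolding d by auto
qed

lemma recursive_diagonal [recursive_intros]:
  assumes "recursive k a"
  shows "recursive k (\<lambda>xs. diagonal (a xs))"
proof (rule recursive_compose1[OF _ assms], rule recursive_cong)
  let ?h = "\<lambda>m r. if 0 < triangle (Suc r) - Suc m then r else Suc r"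
  show "recursive 1 (\<lambda>xs. rec_nat 0 ?h (xs ! 0))"
    by (intro recursive_intros) simp_all
  have "rec_nat 0 ?h n = diagonal n" for n :: nat
    by (induction n) (auto simp: diagonal_Suc, simp add: diagonal_def prod_decode_0)
  then show "diagonal (xs ! 0) = rec_nat 0 ?h (xs ! 0)" for xs by simp
qed

lemma recursive_fst_prod_decode [recursive_intros]:
  assumes "recursive k a"
  shows "recursive k (\<lambda>xs. fst (prod_decode (a xs)))"
proof -
  have eq: "fst (prod_decode n) = n - triangle (diagonal n)" for n
    using triangle_diagonal[of n] by linarith
  show ?thesis unfolding eq by (intro recursive_intros assms)
qed

lemma recursive_snd_prod_decode [recursive_intros]:
  assumes "recursive k a"
  shows "recursive k (\<lambda>xs. snd (prod_decode (a xs)))"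
proof -
  have eq: "snd (prod_decode n) = diagonal n - fst (prod_decode n)" for n
    by (simp add: diagonal_def)
  show ?thesis unfolding eq by (intro recursive_intros assms)
qed

section \<open>Computable functions between types with a Goedel numbering\<close>

class goedel =
  fixes gnum :: "'a \<Rightarrow> nat"
  assumes gnum_inject [simp]: "gnum x = gnum y \<longleftrightarrow> x = y"

instantiation nat :: goedel
begin
definition gnum_nat :: "nat \<Rightarrow> nat" where [simp]: "gnum_nat n = n"
instance by standard simp
end

instantiation bool :: goedel
begin
definition gnum_bool :: "bool \<Rightarrow> nat" where "gnum_bool b = (if b then 1 else 0)"
instance by standard (auto simp: gnum_bool_def)
end

instantiation prod :: (goedel, goedel) goedel
begin
definition gnum_prod :: "'a \<times> 'b \<Rightarrow> nat" where
  "gnum_prod p = prod_encode (gnum (fst p), gnum (snd p))"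
instance by standard (auto simp: gnum_prod_def prod_eq_iff)
end

instantiation list :: (goedel) goedel
begin
definition gnum_list :: "'a list \<Rightarrow> nat" where
  "gnum_list xs = list_encode (map gnum xs)"
instance by standard (auto simp: gnum_list_def list_encode_eq inj_def map_injective)
end

instantiation trm :: goedel
begin
definition gnum_trm :: "trm \<Rightarrow> nat" where "gnum_trm t = enc_term t"
instance
proof
  fix s t :: trm
  have "enc_term s = enc_term t \<Longrightarrow> s = t"
  proof (induction s arbitrary: t)
    case (Var x)
    then show ?case by (cases t) auto
  next
    case (Fun f ss)
    then obtain ts where t: "t = Fun f ts" and eq: "map enc_term ss = map enc_term ts"
      by (cases t) (auto simp: list_encode_eq)
    have "length ss = length ts" using eq by (metis length_map)
    moreover have "ss ! i = ts ! i" if "i < length ss" for i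
      using Fun.IH[of "ss ! i" "ts ! i"] eq that calculation by (metis nth_map nth_mem)
    ultimately show ?case using t by (simp add: nth_equalityI)
  qed
  then show "gnum s = gnum t \<longleftrightarrow> s = t" by (auto simp: gnum_trm_def)
qed
end

text \<open>The tracking function is constrained on codes only; on numbers that code nothing its
  values are free. Speaking about typed functions keeps the arithmetic of codes out of the later
  arguments.\<close>

definition computable :: "('a::goedel \<Rightarrow> 'b::goedel) \<Rightarrow> bool" where
  "computable f \<longleftrightarrow> (\<exists>h. total_computable h \<and> (\<forall>x. h (gnum x) = gnum (f x)))"

lemma computableI:
  assumes "recursive 1 (\<lambda>xs. h (xs ! 0))" "\<And>x. h (gnum x) = gnum (f x)"
  shows "computable f"
  using assms unfolding computable_def total_computable_iff_recursive by blast

lemma computableE: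
  assumes "computable f"
  obtains h where "\<And>k a. recursive k a \<Longrightarrow> recursive k (\<lambda>xs. h (a xs))"
    "\<And>x. h (gnum x) = gnum (f x)"
  using assms recursive_compose1 unfolding computable_def total_computable_iff_recursive by metis

named_theorems computable_intros

lemma computable_id [computable_intros]: "computable (\<lambda>x. x)"
  by (rule computableI[of "\<lambda>x. x"]) (auto intro: recursive_intros)

lemma computable_const [computable_intros]: "computable (\<lambda>x. c)"
  by (rule computableI[of "\<lambda>x. gnum c"]) (auto intro: recursive_intros)

lemma computable_compose:
  assumes "computable g" "computable f"
  shows "computable (\<lambda>x. g (f x))"
proof -
  obtain h where h: "\<And>k a. recursive k a \<Longrightarrow> recursive k (\<lambda>xs. h (a xs))"
    "\<And>x. h (gnum x) = gnum (g x)" using assms(1) by (rule computableE) blast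
  obtain h' where h': "\<And>k a. recursive k a \<Longrightarrow> recursive k (\<lambda>xs. h' (a xs))"
    "\<And>x. h' (gnum x) = gnum (f x)" using assms(2) by (rule computableE) blast
  show ?thesis
    by (rule computableI[of "\<lambda>x. h (h' x)"]) (auto simp: h(2) h'(2) intro!: h(1) h'(1) recursive_intros)
qed

text \<open>Maps such as \<open>gnum\<close>, \<open>prod_decode\<close> and
  \<open>list_decode\<close> change the type but not the code, so the identity tracks them.\<close>

lemma computable_recode: "(\<And>x. gnum (f x) = gnum x) \<Longrightarrow> computable f"
  by (rule computableI[of "\<lambda>x. x"]) (auto intro: recursive_intros)

lemma computable_lift1:
  assumes "recursive 1 (\<lambda>xs. h (xs ! 0))" "\<And>u. h (gnum u) = gnum (g u)" "computable a"
  shows "computable (\<lambda>x. g (a x))"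
  using computable_compose[OF computableI assms(3)] assms(1,2) by blast

lemma computable_Pair [computable_intros]:
  assumes "computable f" "computable g"
  shows "computable (\<lambda>x. (f x, g x))"
proof -
  obtain h where h: "\<And>k a. recursive k a \<Longrightarrow> recursive k (\<lambda>xs. h (a xs))"
    "\<And>x. h (gnum x) = gnum (f x)" using assms(1) by (rule computableE) blast
  obtain h' where h': "\<And>k a. recursive k a \<Longrightarrow> recursive k (\<lambda>xs. h' (a xs))"
    "\<And>x. h' (gnum x) = gnum (g x)" using assms(2) by (rule computableE) blast
  show ?thesis
    by (rule computableI[of "\<lambda>x. prod_encode (h x, h' x)"])
      (auto simp: h(2) h'(2) gnum_prod_def intro!: h(1) h'(1) recursive_intros)
qed

lemma computable_lift2:
  assumes h: "recursive 2 (\<lambda>xs. h (xs ! 0) (xs ! 1))" "\<And>u v. h (gnum u) (gnum v) = gnum (g u v)"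
    and a: "computable a" and b: "computable b"
  shows "computable (\<lambda>x. g (a x) (b x))"
proof -
  have "computable (\<lambda>p. g (fst p) (snd p))"
    by (rule computableI[of "\<lambda>n. h (fst (prod_decode n)) (snd (prod_decode n))"])
      (auto simp: gnum_prod_def h(2) intro!: recursive_compose2[OF h(1)] recursive_intros)
  from computable_compose[OF this computable_Pair[OF a b]] show ?thesis by simp
qed

lemma computable_fst [computable_intros]: "computable f \<Longrightarrow> computable (\<lambda>x. fst (f x))"
  by (erule computable_lift1[rotated -1, of _ "\<lambda>n. fst (prod_decode n)"])
    (auto simp: gnum_prod_def intro!: recursive_intros)

lemma computable_snd [computable_intros]: "computable f \<Longrightarrow> computable (\<lambda>x. snd (f x))"
  by (erule computable_lift1[rotated -1, of _ "\<lambda>n. snd (prod_decode n)"])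
    (auto simp: gnum_prod_def intro!: recursive_intros)

lemma computable_Suc [computable_intros]: "computable f \<Longrightarrow> computable (\<lambda>x. Suc (f x))"
  by (erule computable_lift1[rotated -1, of _ Suc]) (auto intro!: recursive_intros)

lemma computable_diff [computable_intros]:
  fixes f g :: "'a::goedel \<Rightarrow> nat"
  shows "computable f \<Longrightarrow> computable g \<Longrightarrow> computable (\<lambda>x. f x - g x)"
  by (rule computable_lift2[where h = "(-)"]) (auto intro!: recursive_intros)

lemma computable_gnum [computable_intros]: "computable f \<Longrightarrow> computable (\<lambda>x. gnum (f x))"
  by (rule computable_compose[OF computable_recode]) simp_all

lemma computable_prod_decode [computable_intros]:
  "computable f \<Longrightarrow> computable (\<lambda>x. prod_decode (f x))"
  by (rule computable_compose[OF computable_recode]) (simp_all add: gnum_prod_def)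

lemma computable_list_decode [computable_intros]:
  "computable f \<Longrightarrow> computable (\<lambda>x. list_decode (f x))"
  by (rule computable_compose[OF computable_recode]) (simp_all add: gnum_list_def map_idI)

lemma computable_eq [computable_intros]:
  fixes f g :: "'a::goedel \<Rightarrow> 'b::goedel"
  assumes "computable f" "computable g"
  shows "computable (\<lambda>x. f x = g x)"
proof (rule computable_lift2[OF _ _ assms])
  \<comment> \<open>Codes are injective, so equality can be decided on them; the two truncated
    differences vanish together exactly when the codes agree.\<close>
  let ?h = "\<lambda>m n :: nat. 1 - ((m - n) + (n - m))"
  show "recursive 2 (\<lambda>xs. ?h (xs ! 0) (xs ! 1))" by (intro recursive_intros) simp_all
  show "?h (gnum u) (gnum v) = gnum (u = v)" for u v :: 'b
  proof (cases "u = v")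
    case False
    then have "gnum u \<noteq> gnum v" by simp
    then have "?h (gnum u) (gnum v) = 0" by linarith
    then show ?thesis using False by (simp add: gnum_bool_def)
  qed (simp add: gnum_bool_def)
qed

lemma computable_if [computable_intros]:
  fixes f g :: "'a::goedel \<Rightarrow> 'b::goedel"
  assumes b: "computable b" and f: "computable f" and g: "computable g"
  shows "computable (\<lambda>x. if b x then f x else g x)"
proof -
  have "computable (\<lambda>p :: bool \<times> 'b \<times> 'b. if fst p then fst (snd p) else snd (snd p))"
    by (rule computableI[of "\<lambda>n. if 0 < fst (prod_decode n) then fst (prod_decode (snd (prod_decode n)))
          else snd (prod_decode (snd (prod_decode n)))"])
      (auto simp: gnum_prod_def gnum_bool_def intro!: recursive_intros)
  from computable_compose[OF this computable_Pair[OF b computable_Pair[OF f g]]] show ?thesis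
    by (simp only: fst_conv snd_conv)
qed

lemma computable_conj [computable_intros]:
  assumes "computable a" "computable b"
  shows "computable (\<lambda>x. a x \<and> b x)"
proof -
  have eq: "(\<lambda>x. a x \<and> b x) = (\<lambda>x. if a x then b x else False)" by auto
  show ?thesis unfolding eq by (intro computable_intros assms)
qed

lemma computable_imp [computable_intros]:
  assumes "computable a" "computable b"
  shows "computable (\<lambda>x. a x \<longrightarrow> b x)"
proof -
  have eq: "(\<lambda>x. a x \<longrightarrow> b x) = (\<lambda>x. if a x then b x else True)" by auto
  show ?thesis unfolding eq by (intro computable_intros assms)
qed

lemma computable_not [computable_intros]:
  assumes "computable a"
  shows "computable (\<lambda>x. \<not> a x)"
proof -
  have eq: "(\<lambda>x. \<not> a x) = (\<lambda>x. if a x then False else True)" by auto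
  show ?thesis unfolding eq by (intro computable_intros assms)
qed

lemma computable_rec_nat [computable_intros]:
  assumes n: "computable n" and g: "computable g"
    and h: "computable (\<lambda>p. h (fst p) (fst (snd p)) (snd (snd p)))"
  shows "computable (\<lambda>x. rec_nat (g x) (\<lambda>m r. h m r x) (n x))"
proof -
  obtain cn where cn: "\<And>k a. recursive k a \<Longrightarrow> recursive k (\<lambda>xs. cn (a xs))"
    "\<And>x. cn (gnum x) = gnum (n x)" using n by (rule computableE) blast
  obtain cg where cg: "\<And>k a. recursive k a \<Longrightarrow> recursive k (\<lambda>xs. cg (a xs))"
    "\<And>x. cg (gnum x) = gnum (g x)" using g by (rule computableE) blast
  obtain ch where ch: "\<And>k a. recursive k a \<Longrightarrow> recursive k (\<lambda>xs. ch (a xs))"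
    "\<And>p. ch (gnum p) = gnum (h (fst p) (fst (snd p)) (snd (snd p)))"
    using h by (rule computableE) blast
  let ?h = "\<lambda>x. rec_nat (cg x) (\<lambda>m r. ch (prod_encode (m, prod_encode (r, x)))) (cn x)"
  show ?thesis
  proof (rule computableI[of ?h])
    show "recursive 1 (\<lambda>xs. ?h (xs ! 0))"
      by (intro recursive_intros cn(1) cg(1) ch(1)) simp_all
    fix x
    have "rec_nat (cg (gnum x)) (\<lambda>m r. ch (prod_encode (m, prod_encode (r, gnum x)))) m
      = gnum (rec_nat (g x) (\<lambda>m r. h m r x) m)" for m
    proof (induction m)
      case (Suc m)
      then show ?case
        using ch(2)[of "(m, rec_nat (g x) (\<lambda>m r. h m r x) m, x)"] by (simp add: gnum_prod_def)
    qed (simp add: cg)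
    then show "?h (gnum x) = gnum (rec_nat (g x) (\<lambda>m r. h m r x) (n x))" by (simp add: cn)
  qed
qed

section \<open>Operations on lists and terms\<close>

lemma computable_Cons [computable_intros]:
  "computable f \<Longrightarrow> computable g \<Longrightarrow> computable (\<lambda>x. f x # g x)"
  by (rule computable_lift2[where h = "\<lambda>m n. Suc (prod_encode (m, n))"])
    (auto simp: gnum_list_def intro!: recursive_intros)

lemma computable_hd [computable_intros]:
  fixes f :: "'a::goedel \<Rightarrow> 'b::goedel list"
  assumes "computable f"
  shows "computable (\<lambda>x. hd (f x))"
proof (rule computable_lift1[OF _ _ assms])
  \<comment> \<open>\<open>hd []\<close> is unspecified but fixed, so its code is a constant that
    can serve for the empty list.\<close>
  let ?h = "\<lambda>n. if 0 < n then fst (prod_decode (n - 1)) else gnum (hd [] :: 'b)"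
  show "recursive 1 (\<lambda>xs. ?h (xs ! 0))" by (intro recursive_intros) simp_all
  show "?h (gnum u) = gnum (hd u)" for u :: "'b list" by (cases u) (auto simp: gnum_list_def)
qed

lemma computable_tl [computable_intros]:
  fixes f :: "'a::goedel \<Rightarrow> 'b::goedel list"
  assumes "computable f"
  shows "computable (\<lambda>x. tl (f x))"
proof (rule computable_lift1[OF _ _ assms])
  let ?h = "\<lambda>n. if 0 < n then snd (prod_decode (n - 1)) else 0"
  show "recursive 1 (\<lambda>xs. ?h (xs ! 0))" by (intro recursive_intros) simp_all
  show "?h (gnum u) = gnum (tl u)" for u :: "'b list" by (cases u) (auto simp: gnum_list_def)
qed

lemma length_le_gnum: "length xs \<le> gnum xs"
proof (induction xs)
  case (Cons x xs)
  then show ?case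
    using le_prod_encode_2[of "gnum xs" "gnum x"] by (simp add: gnum_list_def)
qed simp

text \<open>Once the list is used up the iteration idles, so any upper bound on the length will do
  as the number of rounds. The code of the list is such a bound and is available for free.\<close>

lemma foldl_eq_rec_nat:
  assumes "length xs \<le> n"
  shows "foldl f a xs = snd (rec_nat (xs, a) (\<lambda>_ p. if fst p = [] then p else (tl (fst p), f (snd p) (hd (fst p)))) n)"
    (is "_ = snd (rec_nat _ ?h n)")
proof -
  have "foldl f (snd (rec_nat (xs, a) ?h m)) (fst (rec_nat (xs, a) ?h m)) = foldl f a xs \<and>
    length (fst (rec_nat (xs, a) ?h m)) = length xs - m" for m
  proof (induction m)
    case (Suc m)
    then show ?case by (cases "fst (rec_nat (xs, a) ?h m)") auto
  qed simp
  from this[of n] show ?thesis using assms by auto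
qed

lemma computable_foldl [computable_intros]:
  assumes l: "computable l" and g: "computable g"
    and h: "computable (\<lambda>p. h (fst p) (fst (snd p)) (snd (snd p)))"
  shows "computable (\<lambda>x. foldl (\<lambda>a e. h a e x) (g x) (l x))"
proof -
  have eq: "(\<lambda>x. foldl (\<lambda>a e. h a e x) (g x) (l x)) = (\<lambda>x. snd (rec_nat (l x, g x)
    (\<lambda>m p. if fst p = [] then p else (tl (fst p), h (snd p) (hd (fst p)) x)) (gnum (l x))))"
    by (rule ext) (rule foldl_eq_rec_nat[OF length_le_gnum])
  have "computable (\<lambda>q. h (snd (fst (snd q))) (hd (fst (fst (snd q)))) (snd (snd q)))"
    using computable_compose[OF h, of "\<lambda>q. (snd (fst (snd q)), hd (fst (fst (snd q))), snd (snd q))"]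
    by (simp add: computable_intros)
  then show ?thesis unfolding eq by (intro computable_intros l g)
qed

lemma computable_rev [computable_intros]:
  fixes l :: "'a::goedel \<Rightarrow> 'b::goedel list"
  assumes "computable l"
  shows "computable (\<lambda>x. rev (l x))"
proof -
  have "foldl (\<lambda>a e. e # a) b xs = rev xs @ b" for xs b :: "'b list"
    by (induction xs arbitrary: b) auto
  from this[of "[]"] have eq: "rev = foldl (\<lambda>a e. e # a) ([] :: 'b list)" by auto
  show ?thesis unfolding eq by (intro computable_intros assms)
qed

lemma computable_append [computable_intros]:
  fixes l m :: "'a::goedel \<Rightarrow> 'b::goedel list"
  assumes "computable l" "computable m"
  shows "computable (\<lambda>x. l x @ m x)"
proof -
  have "foldl (\<lambda>a e. e # a) ys (rev xs) = xs @ ys" for xs ys :: "'b list"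
    by (induction xs arbitrary: ys) auto
  then have eq: "(\<lambda>x. l x @ m x) = (\<lambda>x. foldl (\<lambda>a e. e # a) (m x) (rev (l x)))" by simp
  show ?thesis unfolding eq by (intro computable_intros assms)
qed

lemma computable_map [computable_intros]:
  fixes l :: "'a::goedel \<Rightarrow> 'c::goedel list" and h :: "'c \<Rightarrow> 'a \<Rightarrow> 'b::goedel"
  assumes l: "computable l" and h: "computable (\<lambda>p. h (fst p) (snd p))"
  shows "computable (\<lambda>x. map (\<lambda>e. h e x) (l x))"
proof -
  have "foldl (\<lambda>a e. f e # a) b xs = rev (map f xs) @ b" for f and xs :: "'c list" and b :: "'b list"
    by (induction xs arbitrary: b) auto
  then have eq: "(\<lambda>x. map (\<lambda>e. h e x) (l x)) = (\<lambda>x. rev (foldl (\<lambda>a e. h e x # a) [] (l x)))" by simp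
  have "computable (\<lambda>p. h (fst (snd p)) (snd (snd p)))"
    using computable_compose[OF h, of "\<lambda>p. (fst (snd p), snd (snd p))"]
    by (simp add: computable_intros)
  then show ?thesis unfolding eq by (intro computable_intros l)
qed

lemma computable_concat [computable_intros]:
  fixes l :: "'a::goedel \<Rightarrow> 'b::goedel list list"
  assumes "computable l"
  shows "computable (\<lambda>x. concat (l x))"
proof -
  have "foldl (@) b xs = b @ concat xs" for xs and b :: "'b list"
    by (induction xs arbitrary: b) auto
  then have eq: "(\<lambda>x. concat (l x)) = (\<lambda>x. foldl (\<lambda>a e. a @ e) [] (l x))" by simp
  show ?thesis unfolding eq by (intro computable_intros assms)
qed

lemma computable_length [computable_intros]:
  fixes l :: "'a::goedel \<Rightarrow> 'b::goedel list"
  assumes "computable l"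
  shows "computable (\<lambda>x. length (l x))"
proof -
  have "foldl (\<lambda>a e. Suc a) n xs = length xs + n" for n and xs :: "'b list"
    by (induction xs arbitrary: n) auto
  then have eq: "(\<lambda>x. length (l x)) = (\<lambda>x. foldl (\<lambda>a e. Suc a) 0 (l x))" by simp
  show ?thesis unfolding eq by (intro computable_intros assms)
qed

lemma computable_Ball_set [computable_intros]:
  fixes l :: "'a::goedel \<Rightarrow> 'b::goedel list"
  assumes l: "computable l" and h: "computable (\<lambda>p. h (fst p) (snd p))"
  shows "computable (\<lambda>x. \<forall>e\<in>set (l x). h e x)"
proof -
  have "foldl (\<lambda>a e. a \<and> P e) b xs \<longleftrightarrow> b \<and> (\<forall>e\<in>set xs. P e)" for P b and xs :: "'b list"
    by (induction xs arbitrary: b) auto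
  then have eq: "(\<lambda>x. \<forall>e\<in>set (l x). h e x) = (\<lambda>x. foldl (\<lambda>a e. a \<and> h e x) True (l x))" by simp
  have "computable (\<lambda>p. h (fst (snd p)) (snd (snd p)))"
    using computable_compose[OF h, of "\<lambda>p. (fst (snd p), snd (snd p))"]
    by (simp add: computable_intros)
  then show ?thesis unfolding eq by (intro computable_intros l)
qed

lemma computable_Bex_set [computable_intros]:
  assumes l: "computable l" and h: "computable (\<lambda>p. h (fst p) (snd p))"
  shows "computable (\<lambda>x. \<exists>e\<in>set (l x). h e x)"
proof -
  have eq: "(\<lambda>x. \<exists>e\<in>set (l x). h e x) = (\<lambda>x. \<not> (\<forall>e\<in>set (l x). \<not> h e x))" by simp
  show ?thesis unfolding eq by (intro computable_intros assms)
qed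

lemma computable_drop [computable_intros]:
  fixes l :: "'a::goedel \<Rightarrow> 'b::goedel list"
  assumes "computable n" "computable l"
  shows "computable (\<lambda>x. drop (n x) (l x))"
proof -
  have eq: "drop n xs = rec_nat xs (\<lambda>m r. tl r) n" for n and xs :: "'b list"
    by (induction n) (simp_all add: drop_Suc flip: tl_drop)
  show ?thesis unfolding eq by (intro computable_intros assms)
qed

lemma computable_Var [computable_intros]: "computable f \<Longrightarrow> computable (\<lambda>x. Var (f x))"
  by (erule computable_lift1[rotated -1, of _ "\<lambda>n. prod_encode (0, n)"])
    (auto simp: gnum_trm_def intro!: recursive_intros)

lemma computable_Fun [computable_intros]:
  "computable f \<Longrightarrow> computable ts \<Longrightarrow> computable (\<lambda>x. Fun (f x) (ts x))"
  by (rule computable_lift2[where h = "\<lambda>m n. prod_encode (1, prod_encode (m, n))"])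
    (auto simp: gnum_trm_def gnum_list_def[where 'a=trm] cong: map_cong intro!: recursive_intros)

lemma computable_uncurry2:
  assumes "computable (\<lambda>p. g (fst p) (snd p))" "computable a" "computable b"
  shows "computable (\<lambda>x. g (a x) (b x))"
  using computable_compose[OF assms(1) computable_Pair[OF assms(2,3)]] by simp

lemma computable_uncurry3:
  assumes "computable (\<lambda>p. g (fst p) (fst (snd p)) (snd (snd p)))"
    "computable a" "computable b" "computable c"
  shows "computable (\<lambda>x. g (a x) (b x) (c x))"
  using computable_compose[OF assms(1) computable_Pair[OF assms(2) computable_Pair[OF assms(3,4)]]]
  by simp

lemma computable_upt [computable_intros]:
  assumes "computable n"
  shows "computable (\<lambda>x. [0..<n x])"
proof -
  have eq: "[0..<n] = rec_nat [] (\<lambda>m r. r @ [m]) n" for n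
    by (induction n) auto
  show ?thesis unfolding eq by (intro computable_intros assms)
qed

lemma computable_take [computable_intros]:
  fixes l :: "'a::goedel \<Rightarrow> 'b::goedel list"
  assumes "computable n" "computable l"
  shows "computable (\<lambda>x. take (n x) (l x))"
proof -
  have eq: "take n xs = rev (drop (length xs - n) (rev xs))" for n and xs :: "'b list"
    by (simp add: drop_rev) (metis diff_diff_cancel nat_le_linear take_all diff_is_0_eq' diff_zero)
  show ?thesis unfolding eq by (intro computable_intros assms)
qed

lemma computable_mem [computable_intros]:
  assumes "computable a" "computable l"
  shows "computable (\<lambda>x. a x \<in> set (l x))"
proof -
  have eq: "a x \<in> set (l x) \<longleftrightarrow> (\<exists>e\<in>set (l x). e = a x)" for x by auto
  show ?thesis unfolding eq by (intro computable_intros assms computable_compose[OF assms(1)])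
qed

lemma computable_distinct [computable_intros]:
  fixes l :: "'a::goedel \<Rightarrow> 'b::goedel list"
  assumes "computable l"
  shows "computable (\<lambda>x. distinct (l x))"
proof (rule computable_compose[OF _ assms])
  have eq: "distinct xs \<longleftrightarrow> (\<forall>i\<in>set [0..<length xs]. hd (drop i xs) \<notin> set (drop (Suc i) xs))"
    for xs :: "'b list"
  proof (induction xs)
    case (Cons x xs)
    have "(\<forall>i\<in>set [0..<length (x # xs)]. P i) \<longleftrightarrow> P 0 \<and> (\<forall>i\<in>set [0..<length xs]. P (Suc i))" for P
      by (auto simp: less_Suc_eq_0_disj simp del: upt_Suc)
    then show ?case using Cons.IH by (simp only: drop_Suc_Cons distinct.simps drop_0 list.sel)
  qed simp
  show "computable (distinct :: 'b list \<Rightarrow> bool)"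
    unfolding eq by (intro computable_intros)
qed

section \<open>Recursion on terms\<close>

lemma less_list_encode: "k \<in> set ks \<Longrightarrow> k < list_encode ks"
proof (induction ks)
  case (Cons a ks)
  have "a \<le> prod_encode (a, list_encode ks)" "list_encode ks \<le> prod_encode (a, list_encode ks)"
    by (rule le_prod_encode_1 le_prod_encode_2)+
  then show ?case using Cons by auto
qed simp

lemma less_term_code:
  assumes "prod_decode n = (Suc tag, w)" "prod_decode w = (f, l)" "k \<in> set (list_decode l)"
  shows "k < n"
proof -
  have "k < l" using less_list_encode[OF assms(3)] by simp
  also have "l \<le> w" using le_prod_encode_2[of l f] by (metis assms(2) prod_decode_inverse)
  also have "w \<le> n" using le_prod_encode_2[of w "Suc tag"] by (metis assms(1) prod_decode_inverse)
  finally show ?thesis .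
qed

text \<open>Every nonzero tag is read as \<open>Fun\<close>, which makes the decoder total. It is a
  left inverse of \<open>enc_term\<close> but not injective.\<close>

function dec_term :: "nat \<Rightarrow> trm" where
  "dec_term n = (case prod_decode n of (tag, w) \<Rightarrow>
     if tag = 0 then Var w
     else (case prod_decode w of (f, l) \<Rightarrow> Fun f (map dec_term (list_decode l))))"
  by auto
termination
  by (relation "measure id") (auto intro: less_term_code[OF sym sym] dest!: gr0_implies_Suc)

declare dec_term.simps [simp del]

lemma dec_enc_term [simp]: "dec_term (enc_term t) = t"
proof (induction t)
  case (Fun f ts)
  then show ?case by (subst dec_term.simps) (simp add: map_idI)
qed (subst dec_term.simps, simp)

primrec fold_trm :: "(nat \<Rightarrow> 'b) \<Rightarrow> (nat \<Rightarrow> 'b list \<Rightarrow> 'b) \<Rightarrow> trm \<Rightarrow> 'b" where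
  "fold_trm v f (Var x) = v x"
| "fold_trm v f (Fun g ts) = f g (map (fold_trm v f) ts)"

text \<open>Course-of-values recursion: the table lists the results for all smaller codes, latest first.\<close>

lemma computable_fold_dec_term:
  fixes a :: "nat \<Rightarrow> 'a::goedel \<Rightarrow> 'b::goedel"
  assumes n: "computable n" and a: "computable (\<lambda>p. a (fst p) (snd p))"
    and b: "computable (\<lambda>p. b (fst p) (fst (snd p)) (snd (snd p)))"
  shows "computable (\<lambda>x. fold_trm (\<lambda>v. a v x) (\<lambda>g rs. b g rs x) (dec_term (n x)))"
proof -
  define F where "F x m = fold_trm (\<lambda>v. a v x) (\<lambda>g rs. b g rs x) (dec_term m)" for x m
  \<comment> \<open>The latest result is at the head of the table, so the result for code
    \<open>k\<close> sits at index \<open>m - 1 - k\<close>.\<close>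
  define G where "G m r x = (if fst (prod_decode m) = 0 then a (snd (prod_decode m)) x
    else b (fst (prod_decode (snd (prod_decode m))))
      (map (\<lambda>k. hd (drop (m - 1 - k) r)) (list_decode (snd (prod_decode (snd (prod_decode m)))))) x)"
    for m r x
  define T where "T x m = rec_nat [] (\<lambda>m r. G m r x # r) m" for x m
  have T: "T x m = map (F x) (rev [0..<m])" for x m
  proof (induction m)
    case (Suc m)
    have hd: "hd (drop (m - 1 - k) (T x m)) = F x k" if "k < m" for k
      using that by (simp add: Suc.IH hd_drop_conv_nth rev_nth)
    have "G m (T x m) x = F x m"
    proof (cases "prod_decode m")
      case (Pair tag w)
      show ?thesis
      proof (cases tag)
        case 0
        then show ?thesis by (simp add: G_def F_def dec_term.simps[of m] Pair)
      next
        case (Suc tag')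
        obtain f l where w: "prod_decode w = (f, l)" by fastforce
        have "map (\<lambda>k. hd (drop (m - 1 - k) (T x m))) (list_decode l) = map (F x) (list_decode l)"
          using hd less_term_code[OF Pair[unfolded Suc] w] by simp
        moreover have "G m (T x m) x = b f (map (\<lambda>k. hd (drop (m - 1 - k) (T x m))) (list_decode l)) x"
          by (simp add: G_def Pair Suc w)
        moreover have "F x m = b f (map (F x) (list_decode l)) x"
          unfolding F_def by (simp add: dec_term.simps[of m] Pair Suc w comp_def)
        ultimately show ?thesis by (simp only:)
      qed
    qed
    then show ?case using Suc.IH by (simp add: T_def)
  qed (simp add: T_def)
  have eq: "fold_trm (\<lambda>v. a v x) (\<lambda>g rs. b g rs x) (dec_term (n x)) = hd (T x (Suc (n x)))" for x
    by (simp add: T F_def)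
  have G: "computable (\<lambda>p. G (fst p) (fst (snd p)) (snd (snd p)))"
    unfolding G_def by (intro computable_intros computable_uncurry2[OF a] computable_uncurry3[OF b])
  show ?thesis
    unfolding eq T_def by (intro computable_intros n computable_uncurry3[OF G])
qed

lemma computable_fold_trm [computable_intros]:
  assumes t: "computable t" and a: "computable (\<lambda>p. a (fst p) (snd p))"
    and b: "computable (\<lambda>p. b (fst p) (fst (snd p)) (snd (snd p)))"
  shows "computable (\<lambda>x. fold_trm (\<lambda>v. a v x) (\<lambda>g rs. b g rs x) (t x))"
  using computable_fold_dec_term[OF computable_gnum[OF t] a b] by (simp add: gnum_trm_def)

lemma computable_dec_term [computable_intros]:
  assumes "computable n"
  shows "computable (\<lambda>x. dec_term (n x))"
proof -
  have "fold_trm Var Fun t = t" for t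
    by (induction t) (auto simp: map_idI)
  moreover have "computable (\<lambda>x. fold_trm (\<lambda>v. Var v) (\<lambda>g rs. Fun g rs) (dec_term (n x)))"
    by (rule computable_fold_dec_term[OF assms]) (intro computable_intros)+
  ultimately show ?thesis by simp
qed

text \<open>A fold sees only the results for the arguments. Folding to pairs of a term and its
  result rebuilds the arguments alongside, as in the reduction of primitive recursion to
  iteration.\<close>

lemma computable_rec_trm [computable_intros]:
  fixes a :: "nat \<Rightarrow> 'a::goedel \<Rightarrow> 'b::goedel"
  assumes t: "computable t" and a: "computable (\<lambda>p. a (fst p) (snd p))"
    and b: "computable (\<lambda>p. b (fst p) (fst (snd p)) (snd (snd p)))"
  shows "computable (\<lambda>x. rec_trm (\<lambda>v. a v x) (\<lambda>g rs. b g rs x) (t x))"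
proof -
  have "fold_trm (\<lambda>v. (Var v, f v)) (\<lambda>g rs. (Fun g (map fst rs), h g rs)) t = (t, rec_trm f h t)"
    for f :: "nat \<Rightarrow> 'b" and h t by (induction t) (simp_all add: comp_def map_idI cong: map_cong)
  then have eq: "rec_trm (\<lambda>v. a v x) (\<lambda>g rs. b g rs x) (t x) = snd (fold_trm (\<lambda>v. (Var v, a v x))
     (\<lambda>g rs. (Fun g (map fst rs), b g rs x)) (t x))" for x
    by simp
  show ?thesis
    unfolding eq by (intro computable_intros t computable_uncurry2[OF a] computable_uncurry3[OF b])
qed

section \<open>Enumerating the one-step reducts of a term\<close>

lemma computable_subst [computable_intros]:
  assumes "computable (\<lambda>p. s (fst p) (snd p))" "computable t"
  shows "computable (\<lambda>x. subst (\<lambda>v. s v x) (t x))"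
proof -
  have eq: "subst \<sigma> t = fold_trm \<sigma> Fun t" for \<sigma> t
    by (induction t) (auto cong: map_cong)
  show ?thesis unfolding eq by (intro computable_intros assms)
qed

definition var_list :: "trm \<Rightarrow> nat list" where
  "var_list = fold_trm (\<lambda>x. [x]) (\<lambda>f rs. concat rs)"

lemma set_var_list: "set (var_list t) = vars t"
  by (induction t) (auto simp: var_list_def)

lemma computable_var_list [computable_intros]:
  "computable t \<Longrightarrow> computable (\<lambda>x. var_list (t x))"
  unfolding var_list_def by (intro computable_intros)

lemma computable_wf_term [computable_intros]:
  assumes "computable F" "computable t"
  shows "computable (\<lambda>x. wf_term (F x) (t x))"
proof (rule computable_uncurry2[OF _ assms])
  have eq: "wf_term F t = fold_trm (\<lambda>x. True) (\<lambda>f rs. (f, length rs) \<in> set F \<and> (\<forall>r\<in>set rs. r)) t" for F t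
    by (induction t) auto
  show "computable (\<lambda>p. wf_term (fst p) (snd p))"
    unfolding eq by (intro computable_intros)
qed

lemma computable_wf_trs [computable_intros]:
  assumes "computable R"
  shows "computable (\<lambda>x. wf_trs (R x))"
proof (rule computable_compose[OF _ assms])
  have "fold_trm (\<lambda>x. False) (\<lambda>f rs. True) l \<longleftrightarrow> (\<exists>f ts. l = Fun f ts)" for l
    by (cases l) auto
  then have eq: "wf_trs R \<longleftrightarrow> distinct (map (\<lambda>e. fst e) (fst R)) \<and>
     (\<forall>q\<in>set (snd R). fold_trm (\<lambda>x. False) (\<lambda>f rs. True) (fst q) \<and>
        (\<forall>x\<in>set (var_list (snd q)). x \<in> set (var_list (fst q))) \<and>
        wf_term (fst R) (fst q) \<and> wf_term (fst R) (snd q))" for R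
    unfolding wf_trs_def set_var_list by (auto simp: split_beta)
  show "computable wf_trs" unfolding eq by (intro computable_intros)
qed

text \<open>\<open>hd (drop i rs)\<close> stands for \<open>rs ! i\<close>, since \<open>hd\<close>
  and \<open>drop\<close> already have closure rules for computability.\<close>

definition positions :: "trm \<Rightarrow> nat \<Rightarrow> nat list list" where
  "positions t x = fold_trm (\<lambda>y. if y = x then [[]] else [])
     (\<lambda>f rs. concat (map (\<lambda>i. map (\<lambda>p. i # p) (hd (drop i rs))) [0..<length rs])) t"

definition args :: "trm \<Rightarrow> trm list" where
  "args t = rec_trm (\<lambda>x. []) (\<lambda>f ps. map (\<lambda>p. fst p) ps) t"

definition subterm_at :: "trm \<Rightarrow> nat list \<Rightarrow> trm" where
  "subterm_at t p = foldl (\<lambda>s i. hd (drop i (args s))) t p"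

text \<open>If \<open>s\<close> is an instance of \<open>l\<close>, the matching substitution sends \<open>x\<close> to the subterm of \<open>s\<close>
  at any position of \<open>x\<close> in \<open>l\<close>.\<close>

definition matcher :: "trm \<Rightarrow> trm \<Rightarrow> nat \<Rightarrow> trm" where
  "matcher l s x = subterm_at s (hd (positions l x))"

lemma subterm_at_positions: "p \<in> set (positions l x) \<Longrightarrow> subterm_at (subst \<sigma> l) p = \<sigma> x"
proof (induction l arbitrary: p)
  case (Var y)
  then show ?case by (auto simp: positions_def subterm_at_def split: if_splits)
next
  case (Fun f ts)
  then obtain i q where i: "i < length ts" and p: "p = i # q" and q: "q \<in> set (positions (ts ! i) x)"
    by (auto simp: positions_def hd_drop_conv_nth)
  have "args (subst \<sigma> (Fun f ts)) = map (subst \<sigma>) ts"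
    by (simp add: args_def comp_def)
  then show ?case
    using Fun.IH[OF nth_mem[OF i] q] i by (simp add: subterm_at_def p hd_drop_conv_nth)
qed

lemma positions_nonempty: "x \<in> vars l \<Longrightarrow> positions l x \<noteq> []"
proof (induction l)
  case (Fun f ts)
  then obtain i where "i < length ts" "x \<in> vars (ts ! i)" by (auto simp: in_set_conv_nth)
  then show ?case using Fun.IH[of "ts ! i"]
    by (auto simp: positions_def hd_drop_conv_nth intro!: bexI[of _ i])
qed (simp add: positions_def)

lemma matcher_subst: "x \<in> vars l \<Longrightarrow> matcher l (subst \<sigma> l) x = \<sigma> x"
  unfolding matcher_def by (simp add: positions_nonempty subterm_at_positions)

lemma subst_cong_vars: "(\<And>x. x \<in> vars t \<Longrightarrow> \<sigma> x = \<tau> x) \<Longrightarrow> subst \<sigma> t = subst \<tau> t"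
  by (induction t) auto

text \<open>\<open>matcher\<close> returns garbage when there is no match; comparing the instance of
  the left-hand side with \<open>s\<close> filters this out, and it also settles repeated
  variables.\<close>

definition root_reducts :: "rule list \<Rightarrow> trm \<Rightarrow> trm list" where
  "root_reducts Rs s = concat (map (\<lambda>q. if subst (\<lambda>v. matcher (fst q) s v) (fst q) = s
     then [subst (\<lambda>v. matcher (fst q) s v) (snd q)] else []) Rs)"

definition reducts :: "rule list \<Rightarrow> trm \<Rightarrow> trm list" where
  "reducts Rs t = rec_trm (\<lambda>x. root_reducts Rs (Var x))
     (\<lambda>f ps. root_reducts Rs (Fun f (map (\<lambda>p. fst p) ps)) @
        concat (map (\<lambda>i. map (\<lambda>u. Fun f (take i (map (\<lambda>p. fst p) ps) @ u # drop (Suc i) (map (\<lambda>p. fst p) ps)))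
          (snd (hd (drop i ps)))) [0..<length ps])) t"

lemma set_root_reducts:
  assumes "\<forall>(l, r)\<in>set Rs. vars r \<subseteq> vars l"
  shows "u \<in> set (root_reducts Rs s) \<longleftrightarrow> (\<exists>l r \<sigma>. (l, r) \<in> set Rs \<and> s = subst \<sigma> l \<and> u = subst \<sigma> r)"
proof
  assume "u \<in> set (root_reducts Rs s)"
  then obtain l r where "(l, r) \<in> set Rs" "subst (matcher l s) l = s" "u = subst (matcher l s) r"
    by (auto simp: root_reducts_def split: if_splits)
  then show "\<exists>l r \<sigma>. (l, r) \<in> set Rs \<and> s = subst \<sigma> l \<and> u = subst \<sigma> r" by metis
next
  assume "\<exists>l r \<sigma>. (l, r) \<in> set Rs \<and> s = subst \<sigma> l \<and> u = subst \<sigma> r"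
  then obtain l r \<sigma> where lr: "(l, r) \<in> set Rs" and s: "s = subst \<sigma> l" and u: "u = subst \<sigma> r"
    by blast
  have "subst (matcher l s) l = s"
    unfolding s by (rule subst_cong_vars) (rule matcher_subst)
  moreover have "vars r \<subseteq> vars l" using assms lr by auto
  then have "subst (matcher l s) r = u"
    unfolding s u by (intro subst_cong_vars matcher_subst) auto
  ultimately show "u \<in> set (root_reducts Rs s)"
    using lr by (auto simp: root_reducts_def intro!: bexI[of _ "(l, r)"])
qed

text \<open>Phrasing rewriting below the root by \<open>listrel1\<close> hides the context
  decomposition and makes \<open>lists_accD\<close> applicable to argument lists.\<close>

lemma rstep_iff:
  "(s, u) \<in> rstep Rs \<longleftrightarrow> (\<exists>l r \<sigma>. (l, r) \<in> set Rs \<and> s = subst \<sigma> l \<and> u = subst \<sigma> r) \<or>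
     (\<exists>f ts us. s = Fun f ts \<and> u = Fun f us \<and> (ts, us) \<in> listrel1 (rstep Rs))"
  by (subst rstep.simps) (fastforce simp: listrel1_def)

lemma set_reducts:
  assumes "\<forall>(l, r)\<in>set Rs. vars r \<subseteq> vars l"
  shows "u \<in> set (reducts Rs s) \<longleftrightarrow> (s, u) \<in> rstep Rs"
proof (induction s arbitrary: u)
  case (Var x)
  have "reducts Rs (Var x) = root_reducts Rs (Var x)" by (simp add: reducts_def)
  then show ?case by (subst rstep_iff) (simp add: set_root_reducts[OF assms])
next
  case (Fun f ts)
  have eq: "reducts Rs (Fun f ts) = root_reducts Rs (Fun f ts) @
     concat (map (\<lambda>i. map (\<lambda>u. Fun f (take i ts @ u # drop (Suc i) ts)) (reducts Rs (ts ! i))) [0..<length ts])"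
    by (simp add: reducts_def comp_def)
      (intro arg_cong[of _ _ concat] map_cong refl; simp add: hd_drop_conv_nth)
  have "u \<in> set (reducts Rs (Fun f ts)) \<longleftrightarrow> u \<in> set (root_reducts Rs (Fun f ts)) \<or>
    (\<exists>i<length ts. \<exists>v\<in>set (reducts Rs (ts ! i)). u = Fun f (ts[i := v]))"
    unfolding eq by (auto simp: upd_conv_take_nth_drop image_iff Bex_def)
  also have "\<dots> \<longleftrightarrow> u \<in> set (root_reducts Rs (Fun f ts)) \<or>
    (\<exists>us. u = Fun f us \<and> (ts, us) \<in> listrel1 (rstep Rs))"
    unfolding listrel1_iff_update using Fun.IH by (metis nth_mem)
  finally show ?case by (subst rstep_iff) (auto simp: set_root_reducts[OF assms])
qed

lemma computable_positions [computable_intros]: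
  "computable t \<Longrightarrow> computable n \<Longrightarrow> computable (\<lambda>x. positions (t x) (n x))"
  by (rule computable_uncurry2) (unfold positions_def, intro computable_intros)

lemma computable_args [computable_intros]: "computable t \<Longrightarrow> computable (\<lambda>x. args (t x))"
  unfolding args_def by (intro computable_intros)

lemma computable_subterm_at [computable_intros]:
  "computable t \<Longrightarrow> computable n \<Longrightarrow> computable (\<lambda>x. subterm_at (t x) (n x))"
  unfolding subterm_at_def by (intro computable_intros)

lemma computable_matcher [computable_intros]:
  "computable l \<Longrightarrow> computable s \<Longrightarrow> computable n \<Longrightarrow> computable (\<lambda>x. matcher (l x) (s x) (n x))"
  unfolding matcher_def by (intro computable_intros)

lemma computable_root_reducts [computable_intros]:
  "computable Rs \<Longrightarrow> computable s \<Longrightarrow> computable (\<lambda>x. root_reducts (Rs x) (s x))"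
  by (rule computable_uncurry2) (unfold root_reducts_def, intro computable_intros)

lemma computable_reducts [computable_intros]:
  "computable Rs \<Longrightarrow> computable s \<Longrightarrow> computable (\<lambda>x. reducts (Rs x) (s x))"
  by (rule computable_uncurry2) (unfold reducts_def, intro computable_intros)

section \<open>Membership in the class Pi02\<close>

definition level :: "rule list \<Rightarrow> trm \<Rightarrow> nat \<Rightarrow> trm list" where
  "level Rs t n = rec_nat [t] (\<lambda>_ us. concat (map (\<lambda>u. reducts Rs u) us)) n"

lemma computable_level [computable_intros]:
  "computable Rs \<Longrightarrow> computable t \<Longrightarrow> computable n \<Longrightarrow> computable (\<lambda>x. level (Rs x) (t x) (n x))"
  by (rule computable_uncurry3) (unfold level_def, intro computable_intros)

lemma set_level:
  assumes "\<forall>(l, r)\<in>set Rs. vars r \<subseteq> vars l"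
  shows "u \<in> set (level Rs t n) \<longleftrightarrow> (t, u) \<in> rstep Rs ^^ n"
proof (induction n arbitrary: u)
  case 0
  show ?case by (auto simp: level_def)
next
  case (Suc n)
  have "u \<in> set (level Rs t (Suc n)) \<longleftrightarrow> (\<exists>v\<in>set (level Rs t n). u \<in> set (reducts Rs v))"
    by (simp add: level_def)
  also have "\<dots> \<longleftrightarrow> (t, u) \<in> rstep Rs ^^ Suc n"
    by (auto simp: Suc.IH set_reducts[OF assms])
  finally show ?case .
qed

lemma WN_on_iff_level:
  assumes "\<forall>(l, r)\<in>set (snd R). vars r \<subseteq> vars l"
  shows "WN_on R t \<longleftrightarrow> (\<exists>n. \<exists>u\<in>set (level (snd R) t n). reducts (snd R) u = [])"
proof -
  have "NF R u \<longleftrightarrow> reducts (snd R) u = []" for u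
    using set_reducts[OF assms, of _ u] unfolding NF_def by (metis list.set_intros(1) neq_Nil_conv empty_iff empty_set)
  then show ?thesis
    unfolding WN_on_def rtrancl_is_UN_relpow Bex_def set_level[OF assms] by blast
qed

lemma SN_on_iff_level:
  assumes "\<forall>(l, r)\<in>set (snd R). vars r \<subseteq> vars l"
  shows "SN_on R t \<longleftrightarrow> (\<exists>n. level (snd R) t n = [])"
proof
  assume "\<exists>n. level (snd R) t n = []"
  then obtain n where n: "level (snd R) t n = []" ..
  show "SN_on R t"
    unfolding SN_on_def
  proof
    assume "\<exists>g. g 0 = t \<and> (\<forall>i. (g i, g (Suc i)) \<in> rstep (snd R))"
    then obtain g where "g 0 = t" "\<And>i. (g i, g (Suc i)) \<in> rstep (snd R)" by blast
    then have "(t, g n) \<in> rstep (snd R) ^^ n" by (induction n) auto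
    then show False using n set_level[OF assms, of "g n" t n] by simp
  qed
next
  \<comment> \<open>\<open>?D\<close> marks the terms with reducts at every depth; if it passes to
    some successor each time, an infinite reduction arises.\<close>
  let ?D = "\<lambda>t. \<forall>n. \<exists>u. (t, u) \<in> rstep (snd R) ^^ n"
  assume "SN_on R t"
  show "\<exists>n. level (snd R) t n = []"
  proof (rule ccontr)
    assume "\<not> (\<exists>n. level (snd R) t n = [])"
    then have t: "?D t"
      using set_level[OF assms, of _ t] by (metis list.set_intros(1) neq_Nil_conv)
    have step: "\<exists>v. ?D v \<and> (s, v) \<in> rstep (snd R)" if s: "?D s" for s
    proof (rule ccontr)
      assume "\<not> ?thesis"
      then have "\<forall>v\<in>set (reducts (snd R) s). \<exists>n. \<forall>u. (v, u) \<notin> rstep (snd R) ^^ n"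
        using set_reducts[OF assms] by blast
      then obtain N where N: "\<And>v u. v \<in> set (reducts (snd R) s) \<Longrightarrow> (v, u) \<notin> rstep (snd R) ^^ N v"
        by metis
      \<comment> \<open>The sum bounds all the depths \<open>N v\<close> at once, and a sequence of
        \<open>M\<close> steps from \<open>v\<close> has an initial part of \<open>N v\<close>
        steps.\<close>
      define M where "M = sum_list (map N (reducts (snd R) s))"
      obtain u where "(s, u) \<in> rstep (snd R) ^^ Suc M" using s by blast
      then obtain v where v: "(s, v) \<in> rstep (snd R)" "(v, u) \<in> rstep (snd R) ^^ M"
        by (metis relpow_Suc_E2)
      have "N v \<le> M"
        using v(1) unfolding M_def by (intro member_le_sum_list) (auto simp: set_reducts[OF assms])
      then have "(v, u) \<in> rstep (snd R) ^^ N v O rstep (snd R) ^^ (M - N v)"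
        using v(2) by (metis le_add_diff_inverse relpow_add)
      then show False using N v(1) by (auto simp: set_reducts[OF assms])
    qed
    have "\<exists>g. \<forall>n. (?D (g n) \<and> (n = 0 \<longrightarrow> g n = t)) \<and> (g n, g (Suc n)) \<in> rstep (snd R)"
      by (rule dependent_nat_choice) (use t step in auto)
    then show False using \<open>SN_on R t\<close> unfolding SN_on_def by blast
  qed
qed

definition dec_trs :: "nat \<Rightarrow> trs" where
  "dec_trs n = (map (\<lambda>k. prod_decode k) (list_decode (fst (prod_decode n))),
     map (\<lambda>k. (dec_term (fst (prod_decode k)), dec_term (snd (prod_decode k))))
       (list_decode (snd (prod_decode n))))"

lemma enc_trs_eq_gnum: "enc_trs R = gnum R"
proof -
  have "gnum = prod_encode" by (auto simp: gnum_prod_def)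
  moreover have "gnum = (\<lambda>(l, r). prod_encode (enc_term l, enc_term r))"
    by (auto simp: gnum_prod_def gnum_trm_def)
  ultimately show ?thesis
    by (simp add: enc_trs_def gnum_prod_def[of R] gnum_list_def)
qed

lemma dec_enc_trs: "dec_trs (enc_trs R) = R"
  by (auto simp: dec_trs_def enc_trs_def split_beta comp_def prod_eq_iff intro!: map_idI)

lemma computable_dec_trs [computable_intros]:
  "computable n \<Longrightarrow> computable (\<lambda>x. dec_trs (n x))"
  by (erule computable_compose[rotated]) (unfold dec_trs_def, intro computable_intros)

lemma decidable3I:
  assumes "computable (\<lambda>p. P (fst p) (fst (snd p)) (snd (snd p)))"
  shows "decidable3 P"
proof -
  obtain h where h: "\<And>k a. recursive k a \<Longrightarrow> recursive k (\<lambda>xs. h (a xs))"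
    "\<And>p. h (gnum p) = gnum (P (fst p) (fst (snd p)) (snd (snd p)))"
    using assms by (rule computableE) blast
  have "recursive 3 (\<lambda>xs. h (prod_encode (xs ! 0, prod_encode (xs ! 1, xs ! 2))))"
    by (intro recursive_intros h(1)) simp_all
  then obtain c where c: "\<And>xs. length xs = 3 \<Longrightarrow>
      eval c xs (h (prod_encode (xs ! 0, prod_encode (xs ! 1, xs ! 2))))"
    unfolding recursive_def by blast
  have "eval c [x, y, z] (if P x y z then 1 else 0)" for x y z
    using c[of "[x, y, z]"] h(2)[of "(x, y, z)"] by (simp add: gnum_prod_def gnum_bool_def numeral_2_eq_2)
  then show ?thesis unfolding decidable3_def by blast
qed

text \<open>A statement about all terms becomes one about all codes, since decoding is surjective;
  comparing \<open>x\<close> with the code of \<open>dec_trs x\<close> rejects numbers that encode no TRS.\<close>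

lemma Pi02_uniform:
  fixes Q :: "rule list \<Rightarrow> trm \<Rightarrow> nat \<Rightarrow> bool"
  assumes Q: "computable (\<lambda>p. Q (fst p) (fst (snd p)) (snd (snd p)))"
    and U: "\<And>R t. wf_trs R \<Longrightarrow> U R t \<longleftrightarrow> (\<exists>n. Q (snd R) t n)"
  shows "Pi02 {enc_trs R | R. wf_trs R \<and> (\<forall>t. wf_term (fst R) t \<longrightarrow> U R t)}"
proof -
  define P where "P x y z \<longleftrightarrow> gnum (dec_trs x) = x \<and> wf_trs (dec_trs x) \<and>
    (wf_term (fst (dec_trs x)) (dec_term y) \<longrightarrow> Q (snd (dec_trs x)) (dec_term y) z)" for x y z
  have "decidable3 P"
    unfolding P_def by (intro decidable3I computable_intros computable_uncurry3[OF Q])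
  moreover have "x \<in> {enc_trs R | R. wf_trs R \<and> (\<forall>t. wf_term (fst R) t \<longrightarrow> U R t)} \<longleftrightarrow>
    (\<forall>y. \<exists>z. P x y z)" for x
  proof -
    have "(\<forall>y. \<exists>z. P x y z) \<longleftrightarrow> enc_trs (dec_trs x) = x \<and> wf_trs (dec_trs x) \<and>
       (\<forall>y. wf_term (fst (dec_trs x)) (dec_term y) \<longrightarrow> (\<exists>z. Q (snd (dec_trs x)) (dec_term y) z))"
      unfolding P_def enc_trs_eq_gnum by auto
    also have "\<dots> \<longleftrightarrow> enc_trs (dec_trs x) = x \<and> wf_trs (dec_trs x) \<and>
       (\<forall>t. wf_term (fst (dec_trs x)) t \<longrightarrow> (\<exists>z. Q (snd (dec_trs x)) t z))"
      by (metis dec_enc_term)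
    also have "\<dots> \<longleftrightarrow> (\<exists>R. x = enc_trs R \<and> wf_trs R \<and> (\<forall>t. wf_term (fst R) t \<longrightarrow> (\<exists>z. Q (snd R) t z)))"
      by (metis dec_enc_trs)
    also have "\<dots> \<longleftrightarrow> (\<exists>R. x = enc_trs R \<and> wf_trs R \<and> (\<forall>t. wf_term (fst R) t \<longrightarrow> U R t))"
      using U by (intro arg_cong[of _ _ Ex] ext) auto
    finally show ?thesis by simp
  qed
  ultimately show ?thesis unfolding Pi02_def by blast
qed

lemma wf_trs_vars: "wf_trs R \<Longrightarrow> \<forall>(l, r)\<in>set (snd R). vars r \<subseteq> vars l"
  unfolding wf_trs_def by auto

lemma Pi02_SN_codes: "Pi02 SN_codes"
  unfolding SN_codes_def SN_trs_def
  by (rule Pi02_uniform[where Q = "\<lambda>Rs t n. level Rs t n = []"])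
    (intro computable_intros, rule SN_on_iff_level, erule wf_trs_vars)

lemma Pi02_WN_codes: "Pi02 WN_codes"
  unfolding WN_codes_def WN_trs_def
  by (rule Pi02_uniform[where Q = "\<lambda>Rs t n. \<exists>u\<in>set (level Rs t n). reducts Rs u = []"])
    (intro computable_intros, rule WN_on_iff_level, erule wf_trs_vars)

section \<open>An abstract machine for recursive functions\<close>

abbreviation zr :: trm where "zr \<equiv> Fun 10 []"
abbreviation sc :: "trm \<Rightarrow> trm" where "sc t \<equiv> Fun 11 [t]"
abbreviation nl :: trm where "nl \<equiv> Fun 12 []"
abbreviation cn :: "trm \<Rightarrow> trm \<Rightarrow> trm" where "cn t u \<equiv> Fun 13 [t, u]"
abbreviation pzero :: trm where "pzero \<equiv> Fun 14 []"
abbreviation psuc :: trm where "psuc \<equiv> Fun 15 []"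
abbreviation pproj :: "trm \<Rightarrow> trm" where "pproj i \<equiv> Fun 16 [i]"
abbreviation pcomp :: "trm \<Rightarrow> trm \<Rightarrow> trm \<Rightarrow> trm" where "pcomp f gs vs \<equiv> Fun 17 [f, gs, vs]"
abbreviation pprec :: "trm \<Rightarrow> trm \<Rightarrow> trm" where "pprec g h \<equiv> Fun 18 [g, h]"
abbreviation pmn :: "trm \<Rightarrow> trm \<Rightarrow> trm" where "pmn f i \<equiv> Fun 19 [f, i]"
abbreviation ev :: "trm \<Rightarrow> trm \<Rightarrow> trm \<Rightarrow> trm" where "ev f xs k \<equiv> Fun 20 [f, xs, k]"
abbreviation ret :: "trm \<Rightarrow> trm \<Rightarrow> trm" where "ret v k \<equiv> Fun 21 [v, k]"
abbreviation khalt :: trm where "khalt \<equiv> Fun 22 []"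
abbreviation kcomp :: "trm \<Rightarrow> trm \<Rightarrow> trm \<Rightarrow> trm \<Rightarrow> trm \<Rightarrow> trm" where
  "kcomp f gs vs xs k \<equiv> Fun 23 [f, gs, vs, xs, k]"
abbreviation kprec :: "trm \<Rightarrow> trm \<Rightarrow> trm \<Rightarrow> trm \<Rightarrow> trm" where
  "kprec h n xs k \<equiv> Fun 24 [h, n, xs, k]"
abbreviation kmn :: "trm \<Rightarrow> trm \<Rightarrow> trm \<Rightarrow> trm \<Rightarrow> trm" where
  "kmn f i xs k \<equiv> Fun 25 [f, i, xs, k]"
abbreviation run :: "trm \<Rightarrow> trm \<Rightarrow> trm \<Rightarrow> trm \<Rightarrow> trm" where "run n m y s \<equiv> Fun 26 [n, m, y, s]"
abbreviation chk :: "trm \<Rightarrow> trm \<Rightarrow> trm \<Rightarrow> trm" where "chk u a m \<equiv> Fun 27 [u, a, m]"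

definition csig :: signature where
  "csig = [(10, 0), (11, 1), (12, 0), (13, 2), (14, 0), (15, 0), (16, 1), (17, 3), (18, 2), (19, 2),
     (20, 3), (21, 2), (22, 0), (23, 5), (24, 4), (25, 4)]"

lemma csig_mem [simp]:
  "(10, 0) \<in> set csig" "(11, Suc 0) \<in> set csig" "(12, 0) \<in> set csig" "(13, Suc (Suc 0)) \<in> set csig"
  "(14, 0) \<in> set csig" "(15, 0) \<in> set csig" "(16, Suc 0) \<in> set csig"
  "(17, Suc (Suc (Suc 0))) \<in> set csig" "(18, Suc (Suc 0)) \<in> set csig" "(19, Suc (Suc 0)) \<in> set csig"
  "(20, Suc (Suc (Suc 0))) \<in> set csig" "(22, 0) \<in> set csig"
  by (simp_all add: csig_def)

text \<open>The states are \<open>ev f xs k\<close> (evaluate program \<open>f\<close> on arguments \<open>xs\<close>, then continue with the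
  stack \<open>k\<close>) and \<open>ret v k\<close> (return \<open>v\<close> to \<open>k\<close>).  In \<open>pcomp f gs vs\<close> the inner functions \<open>gs\<close> are
  still to be evaluated, last one first, and \<open>vs\<close> holds the values found so far; \<open>pmn f i\<close> is
  minimisation starting at \<open>i\<close>.\<close>

definition mrules :: "rule list" where
  "mrules =
    [(ev pzero (Var 0) (Var 1), ret zr (Var 1)),
     (ev psuc (cn (Var 0) (Var 1)) (Var 2), ret (sc (Var 0)) (Var 2)),
     (ev (pproj zr) (cn (Var 0) (Var 1)) (Var 2), ret (Var 0) (Var 2)),
     (ev (pproj (sc (Var 0))) (cn (Var 1) (Var 2)) (Var 3), ev (pproj (Var 0)) (Var 2) (Var 3)),
     (ev (pcomp (Var 0) nl (Var 1)) (Var 2) (Var 3), ev (Var 0) (Var 1) (Var 3)),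
     (ev (pcomp (Var 0) (cn (Var 1) (Var 2)) (Var 3)) (Var 4) (Var 5),
        ev (Var 1) (Var 4) (kcomp (Var 0) (Var 2) (Var 3) (Var 4) (Var 5))),
     (ret (Var 0) (kcomp (Var 1) (Var 2) (Var 3) (Var 4) (Var 5)),
        ev (pcomp (Var 1) (Var 2) (cn (Var 0) (Var 3))) (Var 4) (Var 5)),
     (ev (pprec (Var 0) (Var 1)) (cn zr (Var 2)) (Var 3), ev (Var 0) (Var 2) (Var 3)),
     (ev (pprec (Var 0) (Var 1)) (cn (sc (Var 2)) (Var 3)) (Var 4),
        ev (pprec (Var 0) (Var 1)) (cn (Var 2) (Var 3)) (kprec (Var 1) (Var 2) (Var 3) (Var 4))),
     (ret (Var 0) (kprec (Var 1) (Var 2) (Var 3) (Var 4)),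
        ev (Var 1) (cn (Var 2) (cn (Var 0) (Var 3))) (Var 4)),
     (ev (pmn (Var 0) (Var 1)) (Var 2) (Var 3),
        ev (Var 0) (cn (Var 1) (Var 2)) (kmn (Var 0) (Var 1) (Var 2) (Var 3))),
     (ret zr (kmn (Var 0) (Var 1) (Var 2) (Var 3)), ret (Var 1) (Var 3)),
     (ret (sc (Var 0)) (kmn (Var 1) (Var 2) (Var 3) (Var 4)), ev (pmn (Var 1) (sc (Var 2))) (Var 3) (Var 4))]"

text \<open>The machine rules enter the rewrite system only wrapped in \<open>run\<close>, which
  pays for the step; a state is therefore only ever matched as a whole.\<close>

definition mstep :: "(trm \<times> trm) set" where
  "mstep = {p. \<exists>\<sigma>. p \<in> set (map (\<lambda>(l, r). (subst \<sigma> l, subst \<sigma> r)) mrules)}"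

lemma mstepI: "(s, t) \<in> set (map (\<lambda>(l, r). (subst ((!) vs) l, subst ((!) vs) r)) mrules) \<Longrightarrow> (s, t) \<in> mstep"
  unfolding mstep_def by blast

lemma mstepE:
  assumes "(s, t) \<in> mstep"
  obtains l r \<sigma> where "(l, r) \<in> set mrules" "s = subst \<sigma> l" "t = subst \<sigma> r"
  using assms unfolding mstep_def by auto

lemma mstep_zero: "(ev pzero xs k, ret zr k) \<in> mstep"
  by (rule mstepI[of _ _ "[xs, k]"]) (simp add: mrules_def)

lemma mstep_suc: "(ev psuc (cn x xs) k, ret (sc x) k) \<in> mstep"
  by (rule mstepI[of _ _ "[x, xs, k]"]) (simp add: mrules_def)

lemma mstep_proj_0: "(ev (pproj zr) (cn x xs) k, ret x k) \<in> mstep"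
  by (rule mstepI[of _ _ "[x, xs, k]"]) (simp add: mrules_def)

lemma mstep_proj_Suc: "(ev (pproj (sc i)) (cn x xs) k, ev (pproj i) xs k) \<in> mstep"
  by (rule mstepI[of _ _ "[i, x, xs, k]"]) (simp add: mrules_def)

lemma mstep_comp_Nil: "(ev (pcomp f nl vs) xs k, ev f vs k) \<in> mstep"
  by (rule mstepI[of _ _ "[f, vs, xs, k]"]) (simp add: mrules_def)

lemma mstep_comp_Cons: "(ev (pcomp f (cn g gs) vs) xs k, ev g xs (kcomp f gs vs xs k)) \<in> mstep"
  by (rule mstepI[of _ _ "[f, g, gs, vs, xs, k]"]) (simp add: mrules_def)

lemma mstep_kcomp: "(ret v (kcomp f gs vs xs k), ev (pcomp f gs (cn v vs)) xs k) \<in> mstep"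
  by (rule mstepI[of _ _ "[v, f, gs, vs, xs, k]"]) (simp add: mrules_def)

lemma mstep_prec_0: "(ev (pprec g h) (cn zr xs) k, ev g xs k) \<in> mstep"
  by (rule mstepI[of _ _ "[g, h, xs, k]"]) (simp add: mrules_def)

lemma mstep_prec_Suc:
  "(ev (pprec g h) (cn (sc n) xs) k, ev (pprec g h) (cn n xs) (kprec h n xs k)) \<in> mstep"
  by (rule mstepI[of _ _ "[g, h, n, xs, k]"]) (simp add: mrules_def)

lemma mstep_kprec: "(ret v (kprec h n xs k), ev h (cn n (cn v xs)) k) \<in> mstep"
  by (rule mstepI[of _ _ "[v, h, n, xs, k]"]) (simp add: mrules_def)

lemma mstep_mn: "(ev (pmn f i) xs k, ev f (cn i xs) (kmn f i xs k)) \<in> mstep"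
  by (rule mstepI[of _ _ "[f, i, xs, k]"]) (simp add: mrules_def)

lemma mstep_kmn_0: "(ret zr (kmn f i xs k), ret i k) \<in> mstep"
  by (rule mstepI[of _ _ "[f, i, xs, k]"]) (simp add: mrules_def)

lemma mstep_kmn_Suc: "(ret (sc v) (kmn f i xs k), ev (pmn f (sc i)) xs k) \<in> mstep"
  by (rule mstepI[of _ _ "[v, f, i, xs, k]"]) (simp add: mrules_def)

text \<open>A left-hand side is fixed by the head of the program with the list or index it consumes,
  or by the top stack frame with the returned value, so no two rules match the same state.\<close>

lemma mstep_deterministic: "(s, t) \<in> mstep \<Longrightarrow> (s, t') \<in> mstep \<Longrightarrow> t = t'"
  by (auto simp: mstep_def mrules_def)

lemma no_mstep_khalt: "(ret v khalt, t) \<notin> mstep"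
  by (auto simp: mstep_def mrules_def)

text \<open>The bound \<open>10\<close> makes the variables \<open>10\<close>, \<open>11\<close>,
  \<open>12\<close> fresh for the wrapping in \<open>run\<close>.\<close>

lemma mrules_wf:
  assumes "(l, r) \<in> set mrules"
  shows "vars l \<subseteq> {..<10}" "vars r \<subseteq> vars l" "wf_term csig l" "wf_term csig r"
  using assms by (auto simp: mrules_def csig_def)

section \<open>Simulating recursive functions on the machine\<close>

primrec num :: "nat \<Rightarrow> trm" where
  "num 0 = zr"
| "num (Suc n) = sc (num n)"

primrec tlist :: "trm list \<Rightarrow> trm" where
  "tlist [] = nl"
| "tlist (t # ts) = cn t (tlist ts)"

text \<open>Inner programs are stored in reverse: each value is put in front of the earlier ones,
  which restores the order of the arguments.\<close>

fun program :: "recf \<Rightarrow> trm" where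
  "program Z = pzero"
| "program Suc_f = psuc"
| "program (Proj i) = pproj (num i)"
| "program (Comp f gs) = pcomp (program f) (tlist (rev (map program gs))) nl"
| "program (Prec g h) = pprec (program g) (program h)"
| "program (Mn f) = pmn (program f) zr"

lemma mstep_proj:
  "i < length xs \<Longrightarrow> (ev (pproj (num i)) (tlist xs) k, ret (xs ! i) k) \<in> mstep\<^sup>*"
proof (induction xs arbitrary: i)
  case (Cons x xs)
  then show ?case
    by (cases i) (auto intro: mstep_proj_0 converse_rtrancl_into_rtrancl[OF mstep_proj_Suc])
qed simp

text \<open>The hypothesis covers every stack because each argument is evaluated under its own
  \<open>kcomp\<close> frame; \<open>ws\<close> collects the values found so far.\<close>

lemma mstep_comp_args:
  assumes "list_all2 (\<lambda>g v. \<forall>k. (ev g xs k, ret v k) \<in> mstep\<^sup>*) gs vs"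
  shows "(ev (pcomp f (tlist gs) (tlist ws)) xs k, ev f (tlist (rev vs @ ws)) k) \<in> mstep\<^sup>*"
  using assms
proof (induction gs vs arbitrary: ws rule: list_all2_induct)
  case Nil
  show ?case using mstep_comp_Nil by auto
next
  case (Cons g gs v vs)
  have "(ev (pcomp f (tlist (g # gs)) (tlist ws)) xs k,
      ev g xs (kcomp f (tlist gs) (tlist ws) xs k)) \<in> mstep\<^sup>*"
    using mstep_comp_Cons by auto
  also have "(ev g xs (kcomp f (tlist gs) (tlist ws) xs k),
      ret v (kcomp f (tlist gs) (tlist ws) xs k)) \<in> mstep\<^sup>*"
    using Cons.hyps by blast
  also have "(ret v (kcomp f (tlist gs) (tlist ws) xs k),
      ev (pcomp f (tlist gs) (tlist (v # ws))) xs k) \<in> mstep\<^sup>*"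
    using mstep_kcomp by auto
  also have "(ev (pcomp f (tlist gs) (tlist (v # ws))) xs k,
      ev f (tlist (rev (v # vs) @ ws)) k) \<in> mstep\<^sup>*"
    using Cons.IH[of "v # ws"] by simp
  finally show ?case .
qed

text \<open>At least one step is recorded, as a failing search has to be shown to run
  forever.\<close>

lemma mstep_mn_next:
  assumes "(ev f (cn i xs) (kmn f i xs k), ret (sc v) (kmn f i xs k)) \<in> mstep\<^sup>*"
  shows "(ev (pmn f i) xs k, ev (pmn f (sc i)) xs k) \<in> mstep\<^sup>+"
  using mstep_mn assms mstep_kmn_Suc by (meson rtrancl_into_trancl2 rtrancl.rtrancl_into_rtrancl)

text \<open>The stack is arbitrary so that the induction hypotheses apply under the frames
  \<open>kcomp\<close>, \<open>kprec\<close> and \<open>kmn\<close>.\<close>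

lemma eval_simulation:
  "eval f xs v \<Longrightarrow> (ev (program f) (tlist (map num xs)) k, ret (num v) k) \<in> mstep\<^sup>*"
proof (induction f xs v arbitrary: k rule: eval.induct)
  case (eval_Z xs)
  show ?case using mstep_zero by auto
next
  case (eval_Suc x xs)
  show ?case using mstep_suc by auto
next
  case (eval_Proj i xs)
  then show ?case using mstep_proj[of i "map num xs" k] by simp
next
  case (eval_Comp xs gs ys f y)
  have "list_all2 (\<lambda>g v. \<forall>k. (ev g (tlist (map num xs)) k, ret v k) \<in> mstep\<^sup>*)
      (map program gs) (map num ys)"
    using eval_Comp.IH(1) unfolding list_all2_map1 list_all2_map2
    by (rule list_all2_mono) blast
  then have "list_all2 (\<lambda>g v. \<forall>k. (ev g (tlist (map num xs)) k, ret v k) \<in> mstep\<^sup>*)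
      (rev (map program gs)) (rev (map num ys))"
    by (simp only: list_all2_rev)
  from mstep_comp_args[OF this, of "program f" "[]" k]
  have "(ev (program (Comp f gs)) (tlist (map num xs)) k, ev (program f) (tlist (map num ys)) k) \<in> mstep\<^sup>*"
    by (simp add: rev_map)
  then show ?case using eval_Comp.IH(2) by (rule rtrancl_trans)
next
  case (eval_Prec0 g xs y h)
  then show ?case by (auto intro: converse_rtrancl_into_rtrancl[OF mstep_prec_0])
next
  case (eval_PrecS g h n xs r y)
  let ?k = "kprec (program h) (num n) (tlist (map num xs)) k"
  have "(ev (program (Prec g h)) (tlist (map num (Suc n # xs))) k,
      ev (program (Prec g h)) (tlist (map num (n # xs))) ?k) \<in> mstep\<^sup>*"
    using mstep_prec_Suc by auto
  also have "(ev (program (Prec g h)) (tlist (map num (n # xs))) ?k, ret (num r) ?k) \<in> mstep\<^sup>*"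
    by (rule eval_PrecS.IH)
  also have "(ret (num r) ?k, ev (program h) (tlist (map num (n # r # xs))) k) \<in> mstep\<^sup>*"
    using mstep_kprec by auto
  also have "(ev (program h) (tlist (map num (n # r # xs))) k, ret (num y) k) \<in> mstep\<^sup>*"
    by (rule eval_PrecS.IH)
  finally show ?case .
next
  case (eval_Mn f y xs)
  let ?xs = "tlist (map num xs)"
  have "(ev (pmn (program f) zr) ?xs k, ev (pmn (program f) (num i)) ?xs k) \<in> mstep\<^sup>*" if "i \<le> y" for i
    using that
  proof (induction i)
    case (Suc i)
    then obtain v where "(ev (program f) (tlist (map num (i # xs)))
        (kmn (program f) (num i) ?xs k), ret (num (Suc v)) (kmn (program f) (num i) ?xs k)) \<in> mstep\<^sup>*"
      using eval_Mn.IH(2) by (metis Suc_le_lessD gr0_implies_Suc)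
    from mstep_mn_next[OF this[unfolded num.simps list.map tlist.simps]] Suc show ?case
      by (auto intro: rtrancl_trans trancl_into_rtrancl)
  qed simp
  from this[of y] have "(ev (program (Mn f)) ?xs k, ev (pmn (program f) (num y)) ?xs k) \<in> mstep\<^sup>*"
    by simp
  also have "(ev (pmn (program f) (num y)) ?xs k, ev (program f) (tlist (map num (y # xs)))
      (kmn (program f) (num y) ?xs k)) \<in> mstep\<^sup>*"
    using mstep_mn by auto
  also have "(ev (program f) (tlist (map num (y # xs))) (kmn (program f) (num y) ?xs k),
      ret zr (kmn (program f) (num y) ?xs k)) \<in> mstep\<^sup>*"
    using eval_Mn.IH(1) by simp
  also have "(ret zr (kmn (program f) (num y) ?xs k), ret (num y) k) \<in> mstep\<^sup>*"
    using mstep_kmn_0 by auto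
  finally show ?case .
qed

lemma wf_term_num [simp]: "wf_term csig (num n)"
  by (induction n) auto

lemma vars_num [simp]: "vars (num n) = {}"
  by (induction n) auto

lemma wf_term_tlist [simp]: "wf_term csig (tlist ts) \<longleftrightarrow> (\<forall>t\<in>set ts. wf_term csig t)"
  by (induction ts) auto

lemma vars_tlist [simp]: "vars (tlist ts) = (\<Union>t\<in>set ts. vars t)"
  by (induction ts) auto

lemma wf_term_program [simp]: "wf_term csig (program f)"
proof (induction f)
  case (Comp f gs)
  moreover have "wf_term csig (tlist (rev (map program gs)))" using Comp by auto
  ultimately show ?case by simp
qed auto

lemma vars_program [simp]: "vars (program f) = {}"
  by (induction f) auto

section \<open>Uniform termination of the machine with restarts\<close>

definition sig :: signature where
  "sig = csig @ [(26, 4), (27, 3)]"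

text \<open>In \<open>run n m y s\<close>, the machine in state \<open>s\<close> is granted \<open>n\<close> more steps and has used up \<open>m\<close>;
  when the grant is exhausted, it is restarted on input \<open>y\<close> with a grant that is larger by one.
  Before that, \<open>chk\<close> copies \<open>y\<close> symbol by symbol, so that it only gets through if \<open>y\<close> is a numeral.\<close>

definition fixed_rules :: "rule list" where
  "fixed_rules = map (\<lambda>(l, r). (run (sc (Var 10)) (Var 11) (Var 12) l, run (Var 10) (sc (Var 11)) (Var 12) r)) mrules @
    [(run zr (Var 0) (Var 1) (Var 2), chk (Var 1) zr (Var 0)),
     (chk (sc (Var 0)) (Var 1) (Var 2), chk (Var 0) (sc (Var 1)) (Var 2))]"

definition rules :: "trm \<Rightarrow> rule list" where
  "rules I = fixed_rules @ [(chk zr (Var 0) (Var 1), run (sc (Var 1)) zr (Var 0) I)]"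

text \<open>The term \<open>I\<close> is the initial state, with \<open>Var 0\<close> in place of the input.\<close>

locale restart_machine =
  fixes I :: trm
  assumes wf_I: "wf_term csig I" and vars_I: "vars I \<subseteq> {0}"
begin

definition init :: "trm \<Rightarrow> trm" where
  "init a = subst (\<lambda>_. a) I"

inductive root_step :: "trm \<Rightarrow> trm \<Rightarrow> bool" where
  machine: "(s, s') \<in> mstep \<Longrightarrow> root_step (run (sc n) m y s) (run n (sc m) y s')"
| exhausted: "root_step (run zr m y s) (chk y zr m)"
| copy: "root_step (chk (sc u) a m) (chk u (sc a) m)"
| restart: "root_step (chk zr a m) (run (sc m) zr a (init a))"

lemma subst_I: "subst \<sigma> I = init (\<sigma> 0)"
  unfolding init_def using vars_I by (intro subst_cong_vars) auto

lemma root_step_iff: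
  "root_step s u \<longleftrightarrow> (\<exists>l r \<sigma>. (l, r) \<in> set (rules I) \<and> s = subst \<sigma> l \<and> u = subst \<sigma> r)"
proof
  assume "root_step s u"
  then show "\<exists>l r \<sigma>. (l, r) \<in> set (rules I) \<and> s = subst \<sigma> l \<and> u = subst \<sigma> r"
  proof cases
    case (machine st st' n m y)
    then obtain l r \<sigma> where lr: "(l, r) \<in> set mrules" "st = subst \<sigma> l" "st' = subst \<sigma> r"
      by (auto elim: mstepE)
    let ?\<tau> = "\<sigma>(10 := n, 11 := m, 12 := y)"
    have "subst ?\<tau> l = st" "subst ?\<tau> r = st'"
      unfolding lr(2,3) using mrules_wf(1,2)[OF lr(1)] by (auto intro!: subst_cong_vars)
    then have "s = subst ?\<tau> (run (sc (Var 10)) (Var 11) (Var 12) l)"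
      "u = subst ?\<tau> (run (Var 10) (sc (Var 11)) (Var 12) r)"
      using machine by auto
    moreover have "(run (sc (Var 10)) (Var 11) (Var 12) l, run (Var 10) (sc (Var 11)) (Var 12) r) \<in> set (rules I)"
      using lr(1) unfolding rules_def fixed_rules_def by force
    ultimately show ?thesis by blast
  next
    case (exhausted m y st)
    show ?thesis
      by (intro exI[of _ "run zr (Var 0) (Var 1) (Var 2)"] exI[of _ "chk (Var 1) zr (Var 0)"]
          exI[of _ "(!) [m, y, st]"]) (simp add: exhausted rules_def fixed_rules_def)
  next
    case (copy v a m)
    show ?thesis
      by (intro exI[of _ "chk (sc (Var 0)) (Var 1) (Var 2)"] exI[of _ "chk (Var 0) (sc (Var 1)) (Var 2)"]
          exI[of _ "(!) [v, a, m]"]) (simp add: copy rules_def fixed_rules_def)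
  next
    case (restart a m)
    show ?thesis
      by (intro exI[of _ "chk zr (Var 0) (Var 1)"] exI[of _ "run (sc (Var 1)) zr (Var 0) I"]
          exI[of _ "(!) [a, m]"]) (simp add: restart rules_def subst_I)
  qed
next
  assume "\<exists>l r \<sigma>. (l, r) \<in> set (rules I) \<and> s = subst \<sigma> l \<and> u = subst \<sigma> r"
  then obtain l r \<sigma> where lr: "(l, r) \<in> set (rules I)" and s: "s = subst \<sigma> l" and u: "u = subst \<sigma> r"
    by blast
  have m: "(subst \<sigma> l', subst \<sigma> r') \<in> mstep" if "(l', r') \<in> set mrules" for l' r'
    using that unfolding mstep_def by force
  show "root_step s u"
    using lr unfolding s u rules_def fixed_rules_def by (auto simp: subst_I intro!: root_step.intros m)
qed

abbreviation step :: "(trm \<times> trm) set" where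
  "step \<equiv> rstep (rules I)"

lemma step_iff:
  "(s, u) \<in> step \<longleftrightarrow> root_step s u \<or> (\<exists>f ts us. s = Fun f ts \<and> u = Fun f us \<and> (ts, us) \<in> listrel1 step)"
  unfolding root_step_iff by (rule rstep_iff)

lemma root_step_symbol:
  assumes "root_step (Fun f ts) u"
  shows "(f, length ts) = (26, 4) \<or> (f, length ts) = (27, 3)"
  using assms by cases auto

lemma no_root_step_csig: "(f, length ts) \<in> set csig \<Longrightarrow> \<not> root_step (Fun f ts) u"
  using root_step_symbol[of f ts u] by (auto simp: csig_def)

text \<open>\<open>csig\<close> omits \<open>run\<close> and \<open>chk\<close>, and every left-hand
  side has one of them at its root.\<close>

lemma no_step_csig: "wf_term csig t \<Longrightarrow> (t, u) \<notin> step"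
proof (induction t arbitrary: u)
  case (Var x)
  show ?case by (subst step_iff) (auto elim: root_step.cases)
next
  case (Fun f ts)
  then show ?case
    by (subst step_iff) (auto simp: no_root_step_csig listrel1_def)
qed

lemma step_csig_args:
  assumes "\<forall>t\<in>set ts. wf_term csig t"
  shows "(Fun f ts, u) \<in> step \<longleftrightarrow> root_step (Fun f ts) u"
  by (subst step_iff) (use assms no_step_csig in \<open>auto simp: listrel1_def\<close>)

lemma wf_term_subst: "wf_term F t \<Longrightarrow> (\<And>x. x \<in> vars t \<Longrightarrow> wf_term F (\<sigma> x)) \<Longrightarrow> wf_term F (subst \<sigma> t)"
  by (induction t) auto

lemma wf_term_substD: "wf_term F (subst \<sigma> t) \<Longrightarrow> x \<in> vars t \<Longrightarrow> wf_term F (\<sigma> x)"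
  by (induction t) auto

lemma wf_term_mstep: "(s, s') \<in> mstep \<Longrightarrow> wf_term csig s \<Longrightarrow> wf_term csig s'"
  by (elim mstepE) (metis mrules_wf(2,4) subsetD wf_term_subst wf_term_substD)

lemma wf_term_init [simp]: "wf_term csig a \<Longrightarrow> wf_term csig (init a)"
  unfolding init_def by (rule wf_term_subst[OF wf_I])

section \<open>Strong normalization of a term as accessibility\<close>

abbreviation sn :: "trm \<Rightarrow> bool" where
  "sn t \<equiv> t \<in> Wellfounded.acc (step\<inverse>)"

lemma snI: "(\<And>u. (t, u) \<in> step \<Longrightarrow> sn u) \<Longrightarrow> sn t"
  by (rule accI) auto

lemma snD: "sn t \<Longrightarrow> (t, u) \<in> step \<Longrightarrow> sn u"
  by (erule acc_downward) simp

lemma sn_csig: "wf_term csig t \<Longrightarrow> sn t"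
  by (rule snI) (simp add: no_step_csig)

lemma sn_arg:
  assumes "sn (Fun f ts)" "t \<in> set ts"
  shows "sn t"
proof -
  obtain ss us where ts: "ts = ss @ t # us" using assms(2) by (meson split_list)
  have "sn s \<Longrightarrow> s = Fun f (ss @ v # us) \<Longrightarrow> sn v" for s v
  proof (induction s arbitrary: v rule: acc.induct)
    case (accI s)
    show ?case
    proof (rule snI)
      fix w assume "(v, w) \<in> step"
      then have "(s, Fun f (ss @ w # us)) \<in> step" using accI.prems rstep.ctxt by blast
      then show "sn w" using accI.IH by blast
    qed
  qed
  then show ?thesis using assms(1) ts by blast
qed

lemma sn_Fun_no_root:
  assumes "\<forall>t\<in>set ts. sn t" "\<And>ts' u. length ts' = length ts \<Longrightarrow> \<not> root_step (Fun f ts') u"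
  shows "sn (Fun f ts)"
proof -
  have "ts \<in> lists (Wellfounded.acc (step\<inverse>))" using assms(1) by auto
  then have "ts \<in> Wellfounded.acc (listrel1 (step\<inverse>))" by (rule lists_accD)
  then show ?thesis using assms(2)
  proof (induction ts rule: acc.induct)
    case (accI ts)
    show ?case
    proof (rule snI)
      fix u assume "(Fun f ts, u) \<in> step"
      then obtain us where u: "u = Fun f us" and us: "(ts, us) \<in> listrel1 step"
        using accI.prems by (subst (asm) step_iff) auto
      have "length us = length ts" using us by (simp add: listrel1_eq_len)
      then show "sn u" unfolding u using accI us by (simp add: listrel1_converse)
    qed
  qed
qed

lemma sn_constructor:
  "(f, length ts) \<in> set csig \<Longrightarrow> \<forall>t\<in>set ts. sn t \<Longrightarrow> sn (Fun f ts)"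
  by (rule sn_Fun_no_root) (metis no_root_step_csig)+

lemma sn_sc [simp]: "sn (sc t) \<longleftrightarrow> sn t"
  using sn_arg[of 11 "[t]"] sn_constructor[of 11 "[t]"] by (auto simp: csig_def)

lemma sn_subst:
  "wf_term csig t \<Longrightarrow> (\<And>x. x \<in> vars t \<Longrightarrow> sn (\<sigma> x)) \<Longrightarrow> sn (subst \<sigma> t)"
proof (induction t)
  case (Fun f ts)
  have "sn (subst \<sigma> t)" if "t \<in> set ts" for t
    using Fun.IH[OF that] Fun.prems that by auto
  then show ?case using Fun.prems(1) by (auto intro!: sn_constructor)
qed simp

lemma sn_substD: "sn (subst \<sigma> t) \<Longrightarrow> x \<in> vars t \<Longrightarrow> sn (\<sigma> x)"
proof (induction t)
  case (Fun f ts)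
  then obtain t where "t \<in> set ts" "x \<in> vars t" by auto
  moreover have "sn (subst \<sigma> t)" using Fun.prems(1) \<open>t \<in> set ts\<close> by (auto intro: sn_arg)
  ultimately show ?case using Fun.IH by blast
qed simp

text \<open>A machine step rearranges subterms of the old state under symbols of
  \<open>csig\<close>, which create no redex.\<close>

lemma sn_mstep: "(s, s') \<in> mstep \<Longrightarrow> sn s \<Longrightarrow> sn s'"
  by (elim mstepE) (metis mrules_wf(2,4) subsetD sn_subst sn_substD)

lemma sn_init: "sn a \<Longrightarrow> sn (init a)"
  unfolding init_def by (rule sn_subst[OF wf_I])

text \<open>The first argument of \<open>run\<close> and of \<open>chk\<close> drives the recursion:
  it is either rewritten or loses a successor.\<close>

abbreviation descent :: "(trm \<times> trm) set" where
  "descent \<equiv> step\<inverse> \<union> {(t, sc t) | t. True}"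

text \<open>The claim is generalized to every \<open>s\<close> below a stack of successors in a
  normalizing \<open>t\<close>. A step of \<open>s\<close> is a step of \<open>t\<close>; stripping
  a successor keeps \<open>t\<close> and shrinks \<open>s\<close>. This gives a lexicographic
  induction on \<open>t\<close> and the size of \<open>s\<close>.\<close>

lemma sn_imp_acc_descent:
  assumes "sn t"
  shows "t \<in> Wellfounded.acc descent"
proof -
  have "t = (sc ^^ j) s \<Longrightarrow> s \<in> Wellfounded.acc descent" for j s
    using assms
  proof (induction t arbitrary: j s rule: acc.induct)
    case (accI t)
    have ctx: "(s, s') \<in> step \<Longrightarrow> ((sc ^^ j) s, (sc ^^ j) s') \<in> step" for s s' j
    proof (induction j)
      case (Suc j)
      then show ?case using rstep.ctxt[of _ _ _ 11 "[]" "[]"] by simp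
    qed simp
    show ?case using accI.prems
    proof (induction "size s" arbitrary: s j rule: less_induct)
      case less
      show ?case
      proof (rule acc.accI)
        fix r assume "(r, s) \<in> descent"
        then consider "(s, r) \<in> step" | "s = sc r" by auto
        then show "r \<in> Wellfounded.acc descent"
        proof cases
          case 1
          then have "((sc ^^ j) r, t) \<in> step\<inverse>" using ctx less.prems by auto
          then show ?thesis using accI.IH by blast
        next
          case 2
          then have "t = (sc ^^ Suc j) r" using less.prems funpow_swap1[of sc j r] by simp
          then show ?thesis using less.hyps[of r "Suc j"] 2 by simp
        qed
      qed
    qed
  qed
  from this[of 0 t] show ?thesis by simp
qed

text \<open>The outer induction follows \<open>descent\<close> of the first argument, the inner one
  reductions in the others. A root step that strips a successor may replace the other arguments by
  larger ones, because the outer measure drops; \<open>good\<close> is the invariant they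
  keep.\<close>

lemma sn_Fun_descent:
  assumes sn_good: "\<And>ts t. good ts \<Longrightarrow> t \<in> set ts \<Longrightarrow> sn t"
    and step_good: "\<And>ts us. good ts \<Longrightarrow> (ts, us) \<in> listrel1 step \<Longrightarrow> good us"
    and root: "\<And>u ts w. sn u \<Longrightarrow> good ts \<Longrightarrow> root_step (Fun f (u # ts)) w \<Longrightarrow>
      sn w \<or> (\<exists>u' ts'. u = sc u' \<and> w = Fun f (u' # ts') \<and> good ts')"
    and "sn u" "good ts"
  shows "sn (Fun f (u # ts))"
  using sn_imp_acc_descent[OF \<open>sn u\<close>] assms(4,5)
proof (induction u arbitrary: ts rule: acc.induct)
  case (accI u)
  have "ts \<in> lists (Wellfounded.acc (step\<inverse>))" using sn_good[OF \<open>good ts\<close>] by auto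
  then have "ts \<in> Wellfounded.acc (listrel1 (step\<inverse>))" by (rule lists_accD)
  then show ?case using \<open>good ts\<close>
  proof (induction ts rule: acc.induct)
    case inner: (accI ts)
    show ?case
    proof (rule snI)
      fix w assume "(Fun f (u # ts), w) \<in> step"
      then consider "root_step (Fun f (u # ts)) w"
        | us where "w = Fun f us" "(u # ts, us) \<in> listrel1 step"
        by (subst (asm) step_iff) auto
      then show "sn w"
      proof cases
        case 1
        from root[OF \<open>sn u\<close> inner.prems this] show ?thesis
        proof
          assume "\<exists>u' ts'. u = sc u' \<and> w = Fun f (u' # ts') \<and> good ts'"
          then obtain u' ts' where "u = sc u'" "w = Fun f (u' # ts')" "good ts'" by blast
          then show ?thesis using accI.IH[of u' ts'] \<open>sn u\<close> by simp
        qed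
      next
        case 2
        then consider u' where "us = u' # ts" "(u, u') \<in> step"
          | ts' where "us = u # ts'" "(ts, ts') \<in> listrel1 step"
          by (cases us) auto
        then show ?thesis
        proof cases
          case 1
          then show ?thesis
            using accI.IH[of u' ts] inner.prems snD[OF \<open>sn u\<close>] 2 by auto
        next
          case t: 2
          then have "(ts', ts) \<in> listrel1 (step\<inverse>)" by (simp add: listrel1_converse)
          then show ?thesis using inner.IH step_good[OF inner.prems t(2)] t(1) 2(1) by blast
        qed
      qed
    qed
  qed
qed

section \<open>Configurations made of numerals\<close>

lemma sn_literal_run_halting:
  assumes "(s, s') \<in> mstep ^^ K" "\<And>t. (s', t) \<notin> mstep" "wf_term csig s" "K < n"
  shows "sn (run (num n) (num m) (num k) s)"
  using assms
proof (induction K arbitrary: s n m)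
  case 0
  \<comment> \<open>The machine has halted with grant left, so no rule applies; a halted state with
    grant zero would still be restarted. Hence the strict bound on \<open>K\<close>.\<close>
  then obtain n' where n: "n = Suc n'" by (cases n) auto
  show ?case
  proof (rule snI)
    fix u assume "(run (num n) (num m) (num k) s, u) \<in> step"
    then have "root_step (run (num n) (num m) (num k) s) u" using 0 by (subst (asm) step_csig_args) auto
    then show "sn u" using 0 n by cases auto
  qed
next
  case (Suc K)
  then obtain n' where n: "n = Suc n'" by (cases n) auto
  obtain t where t: "(s, t) \<in> mstep" "(t, s') \<in> mstep ^^ K" using Suc.prems(1) by (metis relpow_Suc_E2)
  show ?case
  proof (rule snI)
    fix u assume "(run (num n) (num m) (num k) s, u) \<in> step"
    then have "root_step (run (num n) (num m) (num k) s) u"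
      using Suc.prems by (subst (asm) step_csig_args) auto
    then have "u = run (num n') (num (Suc m)) (num k) t"
      using n t(1) by cases (auto dest: mstep_deterministic)
    then show "sn u"
      using Suc.IH[OF t(2) Suc.prems(2) wf_term_mstep[OF t(1) Suc.prems(3)], of n' "Suc m"] Suc.prems(4) n by simp
  qed
qed

text \<open>\<open>n + m\<close> is constant during a run and equals its grant. A stuck state with
  grant left only ends the reduction earlier.\<close>

lemma sn_literal_run_exhausted:
  assumes "sn (chk (num k) zr (num (n + m)))" "wf_term csig s"
  shows "sn (run (num n) (num m) (num k) s)"
  using assms
proof (induction n arbitrary: m s)
  case 0
  show ?case
  proof (rule snI)
    fix u assume "(run (num 0) (num m) (num k) s, u) \<in> step"
    then have "root_step (run (num 0) (num m) (num k) s) u" using 0 by (subst (asm) step_csig_args) auto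
    then show "sn u" using 0 by cases auto
  qed
next
  case (Suc n)
  show ?case
  proof (rule snI)
    fix u assume "(run (num (Suc n)) (num m) (num k) s, u) \<in> step"
    then have "root_step (run (num (Suc n)) (num m) (num k) s) u"
      using Suc.prems by (subst (asm) step_csig_args) auto
    then obtain s' where "(s, s') \<in> mstep" "u = run (num n) (num (Suc m)) (num k) s'"
      by cases auto
    then show "sn u" using Suc.IH[of "Suc m" s'] Suc.prems wf_term_mstep by simp
  qed
qed

lemma sn_literal_chk:
  assumes "sn (run (num (Suc m)) zr (num (j + i)) (init (num (j + i))))"
  shows "sn (chk (num j) (num i) (num m))"
  using assms
proof (induction j arbitrary: i)
  case 0
  show ?case
  proof (rule snI)
    fix u assume "(chk (num 0) (num i) (num m), u) \<in> step"
    then have "root_step (chk (num 0) (num i) (num m)) u" by (subst (asm) step_csig_args) auto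
    then show "sn u" using 0 by cases auto
  qed
next
  case (Suc j)
  show ?case
  proof (rule snI)
    fix u assume "(chk (num (Suc j)) (num i) (num m), u) \<in> step"
    then have "root_step (chk (num (Suc j)) (num i) (num m)) u" by (subst (asm) step_csig_args) auto
    then have "u = chk (num j) (num (Suc i)) (num m)" by cases auto
    then show "sn u" using Suc.IH[of "Suc i"] Suc.prems by simp
  qed
qed

lemma sn_literal_start:
  assumes "(init (num k), s) \<in> mstep\<^sup>*" "\<And>t. (s, t) \<notin> mstep"
  shows "sn (run (num (Suc M)) zr (num k) (init (num k)))"
proof -
  obtain K where K: "(init (num k), s) \<in> mstep ^^ K" using assms(1) rtrancl_power by blast
  show ?thesis
  \<comment> \<open>The difference bounds the restarts still to come; at zero the grant
    \<open>Suc M\<close> exceeds the running time \<open>K\<close>.\<close>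
  proof (induction "Suc K - M" arbitrary: M)
    case 0
    then show ?case using sn_literal_run_halting[OF K assms(2), of "Suc M" 0 k] by simp
  next
    case (Suc d)
    then have "sn (run (num (Suc (Suc M))) zr (num k) (init (num k)))"
      using Suc.hyps(1)[of "Suc M"] by linarith
    then have "sn (chk (num k) (num 0) (num (Suc M)))" using sn_literal_chk[of "Suc M" k 0] by simp
    then show ?case using sn_literal_run_exhausted[of k "Suc M" 0] by simp
  qed
qed

text \<open>The input of a restarted machine is a numeral once \<open>chk\<close> was entered with the copy \<open>zr\<close>, and
  the next grant then is one, too.  So termination spreads backwards from the literal configurations
  to all terms, in the four rounds \<open>C\<close>, \<open>D\<close>, \<open>E\<close>, \<open>F\<close>.\<close>

lemma sn_all:
  assumes halts: "\<And>k. \<exists>s. (init (num k), s) \<in> mstep\<^sup>* \<and> (\<forall>t. (s, t) \<notin> mstep)"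
  shows "sn t"
proof -
  have sn_num: "sn (num k)" for k by (rule sn_csig) simp
  have no_step_num: "(num k, u) \<notin> step" for k u by (rule no_step_csig) simp
  have literal: "sn (chk (num k) zr (num m))" for k m
    using sn_literal_chk[of m k 0] sn_literal_start halts by (metis add_0_right num.simps(1))
  \<comment> \<open>Grant and state are arbitrary, counter and input are numerals: exhaustion leads
    to a \<open>chk\<close> covered by \<open>literal\<close>.\<close>
  have C: "sn (run n (num m) (num k) s)" if "sn n" "sn s" for n m k s
  proof (rule sn_Fun_descent[where good = "\<lambda>ts. \<exists>m k s. ts = [num m, num k, s] \<and> sn s"])
    fix ts us assume "\<exists>m k s. ts = [num m, num k, s] \<and> sn s" "(ts, us) \<in> listrel1 step"
    then show "\<exists>m k s. us = [num m, num k, s] \<and> sn s"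
      by (auto simp: no_step_num intro: snD)
  next
    fix u ts w
    assume ts: "\<exists>m k s. ts = [num m, num k, s] \<and> sn s" and "root_step (Fun 26 (u # ts)) w"
    from this(2) show "sn w \<or> (\<exists>u' ts'. u = sc u' \<and> w = Fun 26 (u' # ts') \<and>
      (\<exists>m k s. ts' = [num m, num k, s] \<and> sn s))"
    proof cases
      case (machine s s' n m y)
      then show ?thesis using ts sn_mstep by (metis (no_types, lifting) list.inject num.simps(2))
    qed (use ts literal in auto)
  qed (use that sn_num in auto)
  \<comment> \<open>The copy is a numeral, the next grant need not be; the restart resets the
    counter to \<open>zr\<close>, so C applies.\<close>
  have D: "sn (chk u (num k) m)" if "sn u" "sn m" for u k m
  proof (rule sn_Fun_descent[where good = "\<lambda>ts. \<exists>k m. ts = [num k, m] \<and> sn m"])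
    fix ts us assume "\<exists>k m. ts = [num k, m] \<and> sn m" "(ts, us) \<in> listrel1 step"
    then show "\<exists>k m. us = [num k, m] \<and> sn m"
      by (auto simp: no_step_num intro: snD)
  next
    fix u ts w
    assume ts: "\<exists>k m. ts = [num k, m] \<and> sn m" and "root_step (Fun 27 (u # ts)) w"
    from this(2) show "sn w \<or> (\<exists>u' ts'. u = sc u' \<and> w = Fun 27 (u' # ts') \<and>
      (\<exists>k m. ts' = [num k, m] \<and> sn m))"
    proof cases
      case (copy u' a m)
      then show ?thesis using ts by (metis (no_types, lifting) list.inject num.simps(2))
    next
      case (restart a m)
      then show ?thesis using ts C[of "sc m" "init a" 0] sn_init sn_num by auto
    qed auto
  qed (use that sn_num in auto)
  \<comment> \<open>Whatever \<open>y\<close> is, exhaustion starts its copy at \<open>zr\<close>, a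
    numeral, so D applies.\<close>
  have E: "sn (run n m y s)" if "sn n" "sn m" "sn y" "sn s" for n m y s
  proof (rule sn_Fun_descent[where good = "\<lambda>ts. \<exists>m y s. ts = [m, y, s] \<and> sn m \<and> sn y \<and> sn s"])
    fix ts us assume "\<exists>m y s. ts = [m, y, s] \<and> sn m \<and> sn y \<and> sn s" "(ts, us) \<in> listrel1 step"
    then show "\<exists>m y s. us = [m, y, s] \<and> sn m \<and> sn y \<and> sn s"
      by (auto intro: snD)
  next
    fix u ts w
    assume ts: "\<exists>m y s. ts = [m, y, s] \<and> sn m \<and> sn y \<and> sn s" and "root_step (Fun 26 (u # ts)) w"
    from this(2) show "sn w \<or> (\<exists>u' ts'. u = sc u' \<and> w = Fun 26 (u' # ts') \<and>
      (\<exists>m y s. ts' = [m, y, s] \<and> sn m \<and> sn y \<and> sn s))"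
    proof cases
      case (machine s s' n m y)
      then show ?thesis using ts sn_mstep by auto
    next
      case (exhausted m y s)
      then show ?thesis using ts D[of y m 0] by auto
    qed auto
  qed (use that in auto)
  \<comment> \<open>A completed copy restarts the machine with normalizing arguments, which E
    covers.\<close>
  have F: "sn (chk u a m)" if "sn u" "sn a" "sn m" for u a m
  proof (rule sn_Fun_descent[where good = "\<lambda>ts. \<exists>a m. ts = [a, m] \<and> sn a \<and> sn m"])
    fix ts us assume "\<exists>a m. ts = [a, m] \<and> sn a \<and> sn m" "(ts, us) \<in> listrel1 step"
    then show "\<exists>a m. us = [a, m] \<and> sn a \<and> sn m"
      by (auto intro: snD)
  next
    fix u ts w
    assume ts: "\<exists>a m. ts = [a, m] \<and> sn a \<and> sn m" and "root_step (Fun 27 (u # ts)) w"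
    from this(2) show "sn w \<or> (\<exists>u' ts'. u = sc u' \<and> w = Fun 27 (u' # ts') \<and>
      (\<exists>a m. ts' = [a, m] \<and> sn a \<and> sn m))"
    proof cases
      case (copy u' a m)
      then show ?thesis using ts by auto
    next
      case (restart a m)
      then show ?thesis using ts E[of "sc m" zr a "init a"] sn_init sn_num[of 0] by auto
    qed auto
  qed (use that in auto)
  show ?thesis
  proof (induction t)
    case (Var x)
    show ?case by (rule snI) (subst (asm) step_iff, auto elim: root_step.cases)
  next
    case (Fun f ts)
    consider "(f, length ts) = (26, 4)" | "(f, length ts) = (27, 3)"
      | "\<And>ts' u. length ts' = length ts \<Longrightarrow> \<not> root_step (Fun f ts') u"
      by (metis root_step_symbol)
    then show ?case
    proof cases
      case 1
      then obtain n m y s where "ts = [n, m, y, s]" by (auto simp: numeral_eq_Suc length_Suc_conv)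
      then show ?thesis using E Fun 1 by simp
    next
      case 2
      then obtain u a m where "ts = [u, a, m]" by (auto simp: numeral_eq_Suc length_Suc_conv)
      then show ?thesis using F Fun 2 by simp
    next
      case 3
      then show ?thesis using Fun by (intro sn_Fun_no_root) auto
    qed
  qed
qed

lemma sn_imp_SN_on:
  assumes "sn t"
  shows "SN_on (sig, rules I) t"
proof -
  have "\<not> (g 0 = t \<and> (\<forall>i. (g i, g (Suc i)) \<in> step))" for g
    using assms
  proof (induction t arbitrary: g rule: acc.induct)
    case (accI t)
    show ?case
    proof
      assume g: "g 0 = t \<and> (\<forall>i. (g i, g (Suc i)) \<in> step)"
      then have "(g 1, t) \<in> step\<inverse>" by auto
      from accI.IH[OF this, of "\<lambda>i. g (Suc i)"] g show False by simp
    qed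
  qed
  then show ?thesis unfolding SN_on_def by auto
qed

text \<open>On states in \<open>B\<close> the machine can always go on within \<open>B\<close>. The
  configurations formed from numerals and such states are closed under rewriting, and each has a
  successor, so no normal form is reachable.\<close>

lemma not_WN_on_chk:
  assumes "init (num k) \<in> B"
    and B: "\<And>s. s \<in> B \<Longrightarrow> wf_term csig s" "\<And>s. s \<in> B \<Longrightarrow> \<exists>s'\<in>B. (s, s') \<in> mstep"
  shows "\<not> WN_on (sig, rules I) (chk (num k) zr zr)"
proof -
  define N where "N = {run (num n) (num m) (num k) s | n m s. s \<in> B} \<union>
    {chk (num j) (num i) (num m) | j i m. j + i = k}"
  have N_run: "run (num n) (num m) (num k) s \<in> N" if "s \<in> B" for n m s
    using that unfolding N_def by blast
  have N_chk: "chk (num j) (num i) (num m) \<in> N" if "j + i = k" for j i m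
    using that unfolding N_def by blast
  have closed: "(\<exists>u. (t, u) \<in> step) \<and> (\<forall>u. (t, u) \<in> step \<longrightarrow> u \<in> N)" if t: "t \<in> N" for t
  proof -
    consider n m s where "t = run (num n) (num m) (num k) s" "s \<in> B"
      | j i m where "t = chk (num j) (num i) (num m)" "j + i = k"
      using t unfolding N_def by blast
    then show ?thesis
    proof cases
      case 1
      obtain s' where s': "s' \<in> B" "(s, s') \<in> mstep" using B(2) 1 by blast
      have iff: "(t, u) \<in> step \<longleftrightarrow> root_step t u" for u
        unfolding 1 by (rule step_csig_args) (use 1 B in auto)
      show ?thesis
      proof (cases n)
        case 0
        then have "root_step t (chk (num k) zr (num m))" using root_step.exhausted 1 by simp
        moreover have "u = chk (num k) zr (num m)" if "root_step t u" for u
          using that unfolding 1 0 by cases auto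
        moreover have "chk (num k) zr (num m) \<in> N" using N_chk[of k 0 m] by simp
        ultimately show ?thesis unfolding iff by blast
      next
        case (Suc n')
        then have "root_step t (run (num n') (num (Suc m)) (num k) s')"
          using root_step.machine[OF s'(2)] 1 by simp
        moreover have "u = run (num n') (num (Suc m)) (num k) s'" if "root_step t u" for u
          using that s'(2) unfolding 1 Suc by cases (auto dest: mstep_deterministic)
        ultimately show ?thesis unfolding iff using N_run[OF s'(1)] by blast
      qed
    next
      case 2
      have iff: "(t, u) \<in> step \<longleftrightarrow> root_step t u" for u
        unfolding 2 by (rule step_csig_args) auto
      show ?thesis
      proof (cases j)
        case 0
        then have "root_step t (run (num (Suc m)) (num 0) (num k) (init (num k)))"
          using root_step.restart 2 by simp
        moreover have "u = run (num (Suc m)) (num 0) (num k) (init (num k))" if "root_step t u" for u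
          using that 2(2) unfolding 2(1) 0 by cases auto
        ultimately show ?thesis unfolding iff using N_run[OF assms(1)] by blast
      next
        case (Suc j')
        then have "root_step t (chk (num j') (num (Suc i)) (num m))" using root_step.copy 2 by simp
        moreover have "u = chk (num j') (num (Suc i)) (num m)" if "root_step t u" for u
          using that unfolding 2 Suc by cases auto
        moreover have "chk (num j') (num (Suc i)) (num m) \<in> N" by (rule N_chk) (use 2(2) Suc in simp)
        ultimately show ?thesis unfolding iff by blast
      qed
    qed
  qed
  have start: "chk (num k) zr zr \<in> N"
    using N_chk[of k 0 0] by simp
  have "u \<in> N" if "(chk (num k) zr zr, u) \<in> step\<^sup>*" for u
    using that by (induction) (use start closed in blast)+
  then show ?thesis unfolding WN_on_def NF_def using closed by auto
qed

lemma wf_term_csig_sig: "wf_term csig t \<Longrightarrow> wf_term sig t"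
  by (induction t) (auto simp: sig_def)

lemma wf_trs_rules: "wf_trs (sig, rules I)"
proof -
  have "wf_term sig l \<and> wf_term sig r \<and> vars r \<subseteq> vars l" if "(l, r) \<in> set mrules" for l r
    using mrules_wf[OF that] wf_term_csig_sig by blast
  moreover have "distinct (map fst sig)" by (simp add: sig_def csig_def)
  moreover have "(10, 0) \<in> set sig" "(11, Suc 0) \<in> set sig" "(26, 4) \<in> set sig" "(27, 3) \<in> set sig"
    by (auto simp: sig_def csig_def)
  moreover note wf_term_csig_sig[OF wf_I] vars_I
  ultimately show ?thesis
    unfolding wf_trs_def rules_def fixed_rules_def by (fastforce simp: numeral_eq_Suc)
qed

end

section \<open>Hardness\<close>

text \<open>\<open>Var 0\<close> is the slot for the input \<open>y\<close>. Minimisation puts its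
  candidate in front, so \<open>f\<close> receives \<open>z\<close>, \<open>x\<close>,
  \<open>y\<close> in this order.\<close>

definition initial :: "recf \<Rightarrow> nat \<Rightarrow> trm" where
  "initial f x = ev (program (Mn f)) (tlist [num x, Var 0]) khalt"

lemma restart_machine_initial: "restart_machine (initial f x)"
proof
  show "wf_term csig (initial f x)" unfolding initial_def by simp
  show "vars (initial f x) \<subseteq> {0}" unfolding initial_def by auto
qed

lemma subst_closed: "vars t = {} \<Longrightarrow> subst \<sigma> t = t"
  by (induction t) (auto intro: map_idI)

lemma init_initial:
  "restart_machine.init (initial f x) (num y) = ev (program (Mn f)) (tlist (map num [x, y])) khalt"
  by (subst restart_machine.init_def[OF restart_machine_initial]) (simp add: initial_def subst_closed)

text \<open>Three implications form a cycle: success of all searches gives strong normalization,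
  this gives weak normalization, and that gives success again. Value \<open>0\<close> signals a
  witness because minimisation looks for a zero.\<close>

lemma termination_iff_search_succeeds:
  assumes f: "\<And>y z. eval f [z, x, y] (if P y z then 0 else 1)"
  shows "SN_trs (sig, rules (initial f x)) \<longleftrightarrow> (\<forall>y. \<exists>z. P y z)"
    and "WN_trs (sig, rules (initial f x)) \<longleftrightarrow> (\<forall>y. \<exists>z. P y z)"
proof -
  interpret restart_machine "initial f x" by (rule restart_machine_initial)
  let ?R = "(sig, rules (initial f x))"
  have "SN_trs ?R" if P: "\<forall>y. \<exists>z. P y z"
  proof -
    have "\<exists>s. (init (num y), s) \<in> mstep\<^sup>* \<and> (\<forall>t. (s, t) \<notin> mstep)" for y
    proof -
      \<comment> \<open>Minimisation stops at the least witness, as \<open>eval_Mn\<close> demands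
        positive values before it.\<close>
      define z where "z = (LEAST z. P y z)"
      have "P y z" using P unfolding z_def by (meson LeastI)
      moreover have "\<not> P y z'" if "z' < z" for z' using that not_less_Least unfolding z_def by blast
      ultimately have "eval (Mn f) [x, y] z"
        using f by (intro eval_Mn) (metis, metis zero_less_one)
      from eval_simulation[OF this, of khalt] show ?thesis
        unfolding init_initial using no_mstep_khalt by blast
    qed
    then show ?thesis unfolding SN_trs_def by (simp add: sn_all sn_imp_SN_on)
  qed
  moreover have "WN_trs ?R" if "SN_trs ?R"
    unfolding WN_trs_def
  proof (intro allI impI)
    fix t assume "wf_term (fst ?R) t"
    then have "SN_on ?R t" using that unfolding SN_trs_def by blast
    show "WN_on ?R t"
    proof (rule ccontr)
      assume no: "\<not> WN_on ?R t"
      have "\<exists>g. \<forall>n. ((t, g n) \<in> step\<^sup>* \<and> (n = 0 \<longrightarrow> g n = t)) \<and> (g n, g (Suc n)) \<in> step"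
      proof (rule dependent_nat_choice)
        fix s and n :: nat assume "(t, s) \<in> step\<^sup>* \<and> (n = 0 \<longrightarrow> s = t)"
        moreover obtain u where "(s, u) \<in> step"
          using no calculation unfolding WN_on_def NF_def by auto
        ultimately show "\<exists>u. ((t, u) \<in> step\<^sup>* \<and> (Suc n = 0 \<longrightarrow> u = t)) \<and> (s, u) \<in> step"
          by (auto intro: rtrancl_into_rtrancl)
      qed auto
      then show False using \<open>SN_on ?R t\<close> unfolding SN_on_def by auto
    qed
  qed
  moreover have "\<exists>z. P y z" if "WN_trs ?R" for y
  proof (rule ccontr)
    assume no: "\<not> (\<exists>z. P y z)"
    let ?S = "\<lambda>i. ev (pmn (program f) (num i)) (tlist (map num [x, y])) khalt"
    \<comment> \<open>Every state on the way to a later round of the search; the transitive closure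
      guarantees a next step.\<close>
    define B where "B = {s. wf_term csig s \<and> (\<exists>i. (s, ?S i) \<in> mstep\<^sup>+)}"
    have next_S: "(?S i, ?S (Suc i)) \<in> mstep\<^sup>+" for i
    proof -
      have "eval f [i, x, y] (Suc 0)" using f[of i y] no by simp
      from mstep_mn_next[OF eval_simulation[OF this, unfolded list.map num.simps tlist.simps]]
      show ?thesis by simp
    qed
    \<comment> \<open>The initial state is \<open>?S 0\<close>, and its first failing test leads to
      \<open>?S 1\<close>.\<close>
    have "init (num y) \<in> B"
      unfolding B_def using next_S[of 0] wf_term_init[of "num y"]
      by (auto simp: init_initial intro!: exI[of _ "Suc 0"])
    moreover have "\<exists>s'\<in>B. (s, s') \<in> mstep" if s: "s \<in> B" for s
    proof -
      obtain i where "(s, ?S i) \<in> mstep\<^sup>+" using s unfolding B_def by blast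
      then obtain s' where s': "(s, s') \<in> mstep" "(s', ?S i) \<in> mstep\<^sup>*" by (meson tranclD)
      then have "(s', ?S (Suc i)) \<in> mstep\<^sup>+" using next_S by (meson rtrancl_trancl_trancl)
      moreover have "wf_term csig s'" using wf_term_mstep[OF s'(1)] s unfolding B_def by blast
      ultimately show ?thesis using s'(1) unfolding B_def by blast
    qed
    ultimately have "\<not> WN_on ?R (chk (num y) zr zr)"
      by (intro not_WN_on_chk[of y B]) (auto simp: B_def)
    moreover have "wf_term sig (chk (num y) zr zr)"
      using wf_term_csig_sig[OF wf_term_num] by (simp add: sig_def csig_def)
    ultimately show False using that unfolding WN_trs_def by auto
  qed
  ultimately show "SN_trs ?R \<longleftrightarrow> (\<forall>y. \<exists>z. P y z)" "WN_trs ?R \<longleftrightarrow> (\<forall>y. \<exists>z. P y z)" by blast+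
qed

text \<open>The number \<open>x\<close> enters only through \<open>num x\<close> in the restart
  rule; the signature and \<open>fixed_rules\<close> are constants.\<close>

lemma total_computable_enc_trs:
  "total_computable (\<lambda>x. enc_trs (sig, rules (initial f x)))"
proof -
  have num: "num x = rec_nat zr (\<lambda>_ t. sc t) x" for x by (induction x) auto
  have "computable (\<lambda>x. (sig, rules (initial f x)))"
    unfolding rules_def initial_def tlist.simps num by (intro computable_intros)
  then obtain h where "total_computable h" "\<And>x. h x = gnum (sig, rules (initial f x))"
    unfolding computable_def by auto
  moreover from this(2) have "h = (\<lambda>x. enc_trs (sig, rules (initial f x)))"
    unfolding enc_trs_eq_gnum by (rule ext)
  ultimately show ?thesis by simp
qed

lemma Pi02_hard:
  assumes "Pi02 A"
  shows "many_one_reducible A SN_codes" and "many_one_reducible A WN_codes"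
proof -
  obtain P c where c: "\<And>x y z. eval c [x, y, z] (if P x y z then 1 else 0)"
    and A: "\<And>x. x \<in> A \<longleftrightarrow> (\<forall>y. \<exists>z. P x y z)"
    using assms unfolding Pi02_def decidable3_def by blast
  \<comment> \<open>The projections rotate \<open>[z, x, y]\<close> to the order \<open>c\<close>
    expects; the recursion in front swaps \<open>0\<close> and \<open>1\<close>, since
    \<open>c\<close> answers \<open>1\<close> for a witness.\<close>
  define f where "f = Comp (Prec (Comp Suc_f [Z]) Z) [Comp c [Proj 1, Proj 2, Proj 0]]"
  have f: "eval f [z, x, y] (if P x y z then 0 else 1)" for x y z
  proof -
    have "eval (Proj 1) [z, x, y] x" "eval (Proj 2) [z, x, y] y" "eval (Proj 0) [z, x, y] z"
      using eval_Proj[of 1 "[z, x, y]"] eval_Proj[of 2 "[z, x, y]"] eval_Proj[of 0 "[z, x, y]"] by auto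
    then have *: "eval (Comp c [Proj 1, Proj 2, Proj 0]) [z, x, y] (if P x y z then 1 else 0)"
      by (intro eval_Comp[OF _ c]) auto
    have 0: "eval (Prec (Comp Suc_f [Z]) Z) [0] 1"
      by (auto intro!: eval_Prec0 eval_Comp[of _ _ "[0]"] eval_Z eval_Suc[of 0 "[]", simplified])
    then have "eval (Prec (Comp Suc_f [Z]) Z) [1] 0"
      using eval_PrecS[OF 0 eval_Z] by simp
    with 0 have "eval (Prec (Comp Suc_f [Z]) Z) [if P x y z then 1 else 0] (if P x y z then 0 else 1)"
      by simp
    then show ?thesis unfolding f_def using * by (intro eval_Comp) auto
  qed
  let ?R = "\<lambda>x. (sig, rules (initial f x))"
  have wf: "wf_trs (?R x)" for x
    by (rule restart_machine.wf_trs_rules[OF restart_machine_initial])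
  \<comment> \<open>Membership in the code sets speaks of some system with the given code;
    injectivity identifies it with \<open>?R x\<close>.\<close>
  have inj: "enc_trs R = enc_trs R' \<longleftrightarrow> R = R'" for R R' by (metis dec_enc_trs)
  have "x \<in> A \<longleftrightarrow> enc_trs (?R x) \<in> SN_codes" "x \<in> A \<longleftrightarrow> enc_trs (?R x) \<in> WN_codes" for x
    unfolding A SN_codes_def WN_codes_def
    using wf[of x] termination_iff_search_succeeds[where P = "P x", OF f] by (auto simp: inj)
  then show "many_one_reducible A SN_codes" "many_one_reducible A WN_codes"
    unfolding many_one_reducible_def using total_computable_enc_trs by blast+
qed

theorem theorem2:
  shows "Pi02_complete SN_codes \<and> Pi02_complete WN_codes"
  unfolding Pi02_complete_def using Pi02_SN_codes Pi02_WN_codes Pi02_hard by blast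

end
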